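(* Let $t > \sqrt{2}$ be fixed. For each positive integer $n$, let $d_t(n)$ denote the number of partitions of $n$ into distinct parts whose largest part is at most $t\sqrt{n}$; equivalently, $d_t(n)$ is the coefficient of $x^n$ in $\prod_{1\le k \leq t\sqrt{n}} (1+x^k)$. Let $\beta=\beta(t)$ be the unique real number satisfying $$1=\int_0^t \frac{ue^{-\beta u}}{1+e^{-\beta u}}\,du,$$ regarded as a differentiable function of $t\in(\sqrt2,\infty)$ with derivative $\beta'(t)$. Define $$B(t):= 2\beta + t \log \left(1+e^{-\beta t}\right), \qquad A_n(t):= \frac{e^{\frac{\beta t}{2}}+e^{-\frac{\beta t}{2}}}{2\left(1+e^{-\beta t}\right)^{\{t\sqrt{n}\}}}\sqrt{\frac{\beta'(t)}{\pi t}},$$ where $\{\alpha\}=\alpha-\lfloor\alpha\rfloor$ denotes the fractional part. Then, as $n\to\infty$, $$d_t(n) \sim \frac{A_n(t)}{n^{3/4}}e^{B(t)\sqrt{n}}.$$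
   Context: The function $\beta:(\sqrt2,\infty)\to(-\infty,\frac{\pi}{2\sqrt3})$ is well-defined, differentiable and strictly increasing (so $\beta'(t)>0$). $\lfloor\alpha\rfloor$ is the greatest integer at most $\alpha$. *)

theory Defs
  imports
    "HOL-Analysis.Analysis"
    "HOL-Library.Landau_Symbols"
    "HOL-Library.Multiset"
    "HOL-Computational_Algebra.Polynomial"
begin

definition partitions :: "nat \<Rightarrow> nat multiset set" where
  "partitions n = {M. 0 \<notin># M \<and> sum_mset M = n}"

definition distinct_parts :: "nat multiset \<Rightarrow> bool" where
  "distinct_parts M \<longleftrightarrow> (\<forall>k. count M k \<le> 1)"

definition bounded_distinct_partitions :: "real \<Rightarrow> nat \<Rightarrow> nat multiset set" where
  "bounded_distinct_partitions t n =
     {M \<in> partitions n. distinct_parts M \<and> (\<forall>k\<in>#M. real k \<le> t * sqrt (real n))}"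

definition d_part :: "real \<Rightarrow> nat \<Rightarrow> nat" where
  "d_part t n = card (bounded_distinct_partitions t n)"

definition beta :: "real \<Rightarrow> real" where
  "beta t = (THE b. ((\<lambda>u. u * exp (- b * u) / (1 + exp (- b * u))) has_integral 1) {0..t})"

definition B_exp :: "real \<Rightarrow> real" where
  "B_exp t = 2 * beta t + t * ln (1 + exp (- beta t * t))"

definition A_coef :: "nat \<Rightarrow> real \<Rightarrow> real" where
  "A_coef n t = (exp (beta t * t / 2) + exp (- (beta t * t / 2)))
             / (2 * (1 + exp (- beta t * t)) powr frac (t * sqrt (real n)))
           * sqrt (deriv beta t / (pi * t))"

lemma bounded_distinct_partitions_conv:
  "bij_betw mset_set {S. S \<subseteq> {k. 1 \<le> k \<and> real k \<le> t * sqrt (real n)} \<and> \<Sum>S = n}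
     (bounded_distinct_partitions t n)"
proof -
  define K where "K = {k::nat. 1 \<le> k \<and> real k \<le> t * sqrt (real n)}"
  have "K \<subseteq> {.. nat \<lfloor>t * sqrt (real n)\<rfloor>}"
    unfolding K_def by (auto simp: le_nat_floor)
  then have fin: "finite K"
    by (rule finite_subset) simp
  have "bij_betw mset_set {S. S \<subseteq> K \<and> \<Sum>S = n} (bounded_distinct_partitions t n)"
  proof (rule bij_betw_byWitness[where f' = set_mset])
    show "\<forall>S\<in>{S. S \<subseteq> K \<and> \<Sum>S = n}. set_mset (mset_set S) = S"
      using fin by (auto dest: finite_subset)
    have eq: "mset_set (set_mset M) = M" if "distinct_parts M" for M
    proof (rule multiset_eqI)
      fix k
      show "count (mset_set (set_mset M)) k = count M k"
        using that[unfolded distinct_parts_def, rule_format, of k]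
        by (cases "k \<in># M") (auto simp: count_eq_zero_iff le_Suc_eq)
    qed
    show "\<forall>M\<in>bounded_distinct_partitions t n. mset_set (set_mset M) = M"
      by (auto simp: bounded_distinct_partitions_def eq)
    show "mset_set ` {S. S \<subseteq> K \<and> \<Sum>S = n} \<subseteq> bounded_distinct_partitions t n"
    proof clarify
      fix S assume S: "S \<subseteq> K" "n = \<Sum>S"
      have "finite S" using S(1) fin finite_subset by blast
      then show "mset_set S \<in> bounded_distinct_partitions t (\<Sum>S)"
        using S by (auto simp: bounded_distinct_partitions_def partitions_def
            distinct_parts_def K_def count_mset_set' sum_unfold_sum_mset)
    qed
    show "set_mset ` bounded_distinct_partitions t n \<subseteq> {S. S \<subseteq> K \<and> \<Sum>S = n}"
    proof clarify
      fix M assume M: "M \<in> bounded_distinct_partitions t n"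
      have "\<Sum>(set_mset M) = sum_mset (mset_set (set_mset M))"
        by (simp add: sum_unfold_sum_mset)
      also have "\<dots> = n"
        using M eq by (auto simp: bounded_distinct_partitions_def partitions_def)
      finally show "set_mset M \<subseteq> K \<and> \<Sum>(set_mset M) = n"
        using M by (auto simp: bounded_distinct_partitions_def partitions_def K_def Suc_le_eq
            intro: gr0I)
    qed
  qed
  then show ?thesis unfolding K_def .
qed

lemma d_part_eq_coeff:
  "of_nat (d_part t n) = coeff (\<Prod>k | 1 \<le> k \<and> real k \<le> t * sqrt (real n). 1 + monom (1::int) k) n"
proof -
  define K where "K = {k::nat. 1 \<le> k \<and> real k \<le> t * sqrt (real n)}"
  have "K \<subseteq> {.. nat \<lfloor>t * sqrt (real n)\<rfloor>}"
    unfolding K_def by (auto simp: le_nat_floor)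
  then have fin: "finite K"
    by (rule finite_subset) simp
  have mono: "(\<Prod>k\<in>S. monom (1::int) k) = monom 1 (\<Sum>S)" for S
    by (induction S rule: infinite_finite_induct) (auto simp: mult_monom)
  have "(\<Prod>k\<in>K. 1 + monom (1::int) k) = (\<Prod>k\<in>K. monom (1::int) k + 1)"
    by (simp add: add.commute)
  also have "\<dots> = (\<Sum>S\<in>Pow K. monom 1 (\<Sum>S))"
    by (simp add: prod_add[OF fin] mono)
  finally have "coeff (\<Prod>k\<in>K. 1 + monom (1::int) k) n = (\<Sum>S\<in>Pow K. if \<Sum>S = n then 1 else 0)"
    by (simp add: coeff_sum)
  also have "\<dots> = of_nat (card {S \<in> Pow K. \<Sum>S = n})"
    using fin by (simp add: sum.If_cases Int_def)
  also have "\<dots> = of_nat (d_part t n)"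
    using bij_betw_same_card[OF bounded_distinct_partitions_conv[of t n]]
    by (simp add: d_part_def K_def)
  finally show ?thesis by (simp add: K_def)
qed

end

theory Submission
  imports
    Defs
    "HOL-Probability.Characteristic_Functions"
    "HOL-Probability.Sinc_Integral"
begin

text \<open>
  Saddle point method in probabilistic form. Give every \<open>k \<le> t \<surd>n\<close> an independent Bernoulli variable
  \<open>X\<^sub>k\<close> with odds \<open>q\<^sub>k = exp (- \<beta> k / \<surd>n)\<close>. Every partition counted by \<open>d\<^sub>t(n)\<close> then has the same
  probability, so \<open>d\<^sub>t(n) = exp (\<beta> \<surd>n) \<cdot> (\<Prod>k. 1 + q\<^sub>k) \<cdot> P(\<Sum>k. k X\<^sub>k = n)\<close>. The equation defining
  \<open>\<beta>\<close> says that the sum has mean \<open>n + O(\<surd>n)\<close>, while its variance is asymptotic to \<open>V n\<^bsup>3/2\<^esup>\<close>; a local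
  central limit theorem, obtained from Fourier inversion and dominated convergence, makes the
  probability asymptotic to \<open>(2 \<pi> V)\<^bsup>-1/2\<^esup> n\<^bsup>-3/4\<^esup>\<close>. The product is evaluated up to a factor
  \<open>1 + o(1)\<close> by the trapezoidal rule, the fractional part of \<open>t \<surd>n\<close> coming from the incomplete
  last interval. Implicit differentiation gives \<open>\<beta>'(t) = t q / ((1 + q) V)\<close> with
  \<open>q = exp (- \<beta> t)\<close>, which turns \<open>V\<close> into the stated constant.
\<close>

section \<open>The saddle point\<close>

text \<open>The probability belonging to odds \<open>exp (- b * u)\<close>: the chance that a part
  of scaled size \<open>u\<close> occurs under the tilted measure.\<close>

definition logis :: "real \<Rightarrow> real \<Rightarrow> real" where
  "logis b u = exp (- b * u) / (1 + exp (- b * u))"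

lemma one_plus_exp_neq_0 [simp]: "1 + exp (x::real) \<noteq> 0"
  by (metis add_pos_pos exp_gt_zero less_irrefl zero_less_one)

lemma one_plus_exp_pos [simp]: "0 < 1 + exp (x::real)"
  by (simp add: add_pos_pos)

lemma logis_pos: "0 < logis b u" and logis_less_1: "logis b u < 1"
  by (simp_all add: logis_def field_simps)

lemma one_minus_logis: "1 - logis b u = logis (-b) u"
  by (simp add: logis_def divide_simps) (simp add: algebra_simps flip: exp_add)

lemma logis_deriv [derivative_intros]:
  "((\<lambda>u. logis b u) has_real_derivative (- b * (logis b u * (1 - logis b u)))) (at u within A)"
  unfolding logis_def
  by (rule derivative_eq_intros refl | simp)+ (simp add: divide_simps power2_eq_square algebra_simps)

lemma logis_deriv_param:
  "((\<lambda>b. logis b u) has_real_derivative (- u * (logis b u * (1 - logis b u)))) (at b within A)"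
  unfolding logis_def
  by (rule derivative_eq_intros refl | simp)+ (simp add: divide_simps power2_eq_square algebra_simps)

lemma continuous_on_logis [continuous_intros]:
  fixes f g :: "'a::t2_space \<Rightarrow> real"
  shows "continuous_on A f \<Longrightarrow> continuous_on A g \<Longrightarrow> continuous_on A (\<lambda>x. logis (f x) (g x))"
  unfolding logis_def by (intro continuous_intros) auto

definition moment :: "real \<Rightarrow> real \<Rightarrow> real" where
  "moment s b = integral {0..s} (\<lambda>u. u * logis b u)"

text \<open>The integrand is \<open>u^2\<close> times a Bernoulli variance, so this is the limiting
  variance of the tilted sum after rescaling.\<close>

definition limit_var :: "real \<Rightarrow> real \<Rightarrow> real" where
  "limit_var s b = integral {0..s} (\<lambda>u. u\<^sup>2 * (logis b u * (1 - logis b u)))"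

lemma moment_has_integral: "((\<lambda>u. u * logis b u) has_integral moment s b) {0..s}"
  unfolding moment_def
  by (intro integrable_integral integrable_continuous_interval continuous_intros)

lemma limit_var_has_integral:
  "((\<lambda>u. u\<^sup>2 * (logis b u * (1 - logis b u))) has_integral limit_var s b) {0..s}"
  unfolding limit_var_def
  by (intro integrable_integral integrable_continuous_interval continuous_intros)

text \<open>Differentiation under the integral sign: the tilt parameter brings down
  \<open>- u\<close> and a Bernoulli variance, the usual relation between mean and variance in an
  exponential family.\<close>

lemma moment_deriv:
  "(moment s has_real_derivative - limit_var s b) (at b)"
proof -
  have "((\<lambda>b. integral (cbox 0 s) (\<lambda>u. u * logis b u)) has_field_derivative
      integral (cbox 0 s) (\<lambda>u. - (u\<^sup>2 * (logis b u * (1 - logis b u))))) (at b within UNIV)"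
  proof (rule leibniz_rule_field_derivative)
    show "((\<lambda>b. u * logis b u) has_field_derivative - (u\<^sup>2 * (logis b u * (1 - logis b u))))
        (at b within UNIV)" for b u
      using DERIV_cmult[OF logis_deriv_param[of u b UNIV], of u]
      by (simp add: power2_eq_square mult.assoc)
    show "(\<lambda>u. u * logis b u) integrable_on cbox 0 s" for b
      using moment_has_integral by auto
    show "continuous_on (UNIV \<times> cbox 0 s) (\<lambda>(b, u). - (u\<^sup>2 * (logis b u * (1 - logis b u))))"
      unfolding split_beta by (intro continuous_intros)
  qed auto
  then show ?thesis
    by (simp add: moment_def[abs_def] limit_var_def)
qed

text \<open>If a continuous nonnegative integrand had integral zero it would vanish on the whole
  interval, but at the endpoint \<open>s\<close> it is positive.\<close>

lemma limit_var_pos: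
  assumes "s > 0" shows "limit_var s b > 0"
proof -
  have nn: "0 \<le> u\<^sup>2 * (logis b u * (1 - logis b u))" for u
    using logis_pos[of b u] logis_less_1[of b u] by simp
  have ge: "0 \<le> limit_var s b"
    by (rule has_integral_nonneg[OF limit_var_has_integral]) (use nn in auto)
  have "limit_var s b \<noteq> 0"
  proof
    assume "limit_var s b = 0"
    then have "((\<lambda>u. u\<^sup>2 * (logis b u * (1 - logis b u))) has_integral 0) (cbox 0 s)"
      using limit_var_has_integral[of b s] by simp
    moreover have "continuous_on (cbox 0 s) (\<lambda>u. u\<^sup>2 * (logis b u * (1 - logis b u)))"
      by (intro continuous_intros)
    ultimately have "s\<^sup>2 * (logis b s * (1 - logis b s)) = 0"
      using has_integral_0_cbox_imp_0[of 0 s "\<lambda>u. u\<^sup>2 * (logis b u * (1 - logis b u))" s] nn assms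
      by auto
    then show False
      using assms logis_pos[of b s] logis_less_1[of b s] by auto
  qed
  with ge show ?thesis by simp
qed

lemma moment_strict_antimono:
  assumes "s > 0" "b < c" shows "moment s c < moment s b"
  using assms moment_deriv[of s] limit_var_pos[of s]
  by (intro DERIV_neg_imp_decreasing[OF \<open>b < c\<close>]) (meson neg_less_0_iff_less)

text \<open>Follows from \<open>logis b u <= exp (- (b * u))\<close> and \<open>x <= exp x\<close>
  at \<open>x = b * u\<close>. It controls the moment at both ends of the intermediate value
  argument below.\<close>

lemma logis_upper: "b > 0 \<Longrightarrow> u \<ge> 0 \<Longrightarrow> u * logis b u \<le> 1 / b"
proof -
  assume b: "b > 0" and u: "u \<ge> 0"
  have "logis b u \<le> exp (- (b * u))"
    by (simp add: logis_def field_simps)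
  then have "(b * u) * logis b u \<le> (b * u) * exp (- (b * u))"
    using b u by (intro mult_left_mono) auto
  also have "\<dots> \<le> exp (b * u) * exp (- (b * u))"
    using exp_ge_add_one_self[of "b * u"] by (intro mult_right_mono) (linarith, simp)
  also have "\<dots> = 1" by (simp flip: exp_add)
  finally show ?thesis using b by (simp add: field_simps)
qed

text \<open>Strict monotonicity gives uniqueness, the intermediate value theorem existence. The
  hypothesis says \<open>s^2 / 2 > 1\<close>, where \<open>s^2 / 2\<close> is the limit of the
  moment as the tilt tends to minus infinity.\<close>

lemma ex1_moment_eq_1:
  assumes "s > sqrt 2" shows "\<exists>!b. moment s b = 1"
proof -
  have s: "s > 0" "s\<^sup>2 > 2"
    using assms real_sqrt_gt_zero[of 2] power_strict_mono[of "sqrt 2" s 2] by (linarith, simp)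
  \<comment> \<open>Chosen to make \<open>s / c <= s^2 / 2 - 1\<close>. By the reflection
    \<open>one_minus_logis\<close> the integrand at \<open>- c\<close> is at least
    \<open>u - 1 / c\<close>, so the moment there is at least 1.\<close>
  define c where "c = 2 * (s + 1) / (s\<^sup>2 - 2)"
  have c: "c > 0" using s by (simp add: c_def)
  have upper: "moment s (s + 1) \<le> 1"
  proof -
    have "moment s (s + 1) \<le> s * (1 / (s + 1))"
      using s logis_upper[of "s+1"] has_integral_const_real[of "1/(s+1)" 0 s]
      by (intro has_integral_le[OF moment_has_integral[of "s+1" s]]) auto
    also have "\<dots> \<le> 1" using s by simp
    finally show ?thesis .
  qed
  have lower: "moment s (-c) \<ge> 1"
  proof -
    have "((\<lambda>u. u) has_integral (s\<^sup>2 / 2 - 0\<^sup>2 / 2)) {0..s}"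
      using ident_has_integral[of 0 s] s by simp
    then have "((\<lambda>u. u - 1 / c) has_integral (s\<^sup>2 / 2 - s * (1 / c))) {0..s}"
      using has_integral_const_real[of "1/c" 0 s] s by (auto intro: has_integral_diff)
    then have "s\<^sup>2 / 2 - s * (1 / c) \<le> moment s (-c)"
    proof (rule has_integral_le[OF _ moment_has_integral])
      fix u assume "u \<in> {0..s}"
      then show "u - 1 / c \<le> u * logis (- c) u"
        using logis_upper[OF c, of u] one_minus_logis[of c u] by (simp add: algebra_simps flip: one_minus_logis)
    qed
    moreover have "s * (1 / c) \<le> s\<^sup>2 / 2 - 1"
      using s by (simp add: c_def field_simps)
    ultimately show ?thesis by simp
  qed
  have "\<exists>b\<ge>-c. b \<le> s + 1 \<and> moment s b = 1"
    by (rule IVT2) (use upper lower c s in \<open>auto intro!: DERIV_isCont moment_deriv\<close>)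
  then show ?thesis
    using moment_strict_antimono[OF s(1)] by (metis less_irrefl linorder_neqE)
qed

lemma beta_eq: "beta s = (THE b. moment s b = 1)"
proof -
  have "((\<lambda>u. u * exp (- b * u) / (1 + exp (- b * u))) has_integral 1) {0..s} \<longleftrightarrow>
      moment s b = 1" for b
  proof -
    have "(\<lambda>u. u * exp (- b * u) / (1 + exp (- b * u))) = (\<lambda>u. u * logis b u)"
      by (simp add: logis_def)
    then show ?thesis
      using moment_has_integral[of b s] has_integral_unique[OF moment_has_integral[of b s], of 1]
      by metis
  qed
  then show ?thesis unfolding beta_def by simp
qed

lemma moment_beta: "s > sqrt 2 \<Longrightarrow> moment s (beta s) = 1"
  unfolding beta_eq by (rule theI'[OF ex1_moment_eq_1])

section \<open>Continuity and derivative of \<open>beta\<close>\<close>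

lemma moment_deriv_upper:
  assumes "s > 0"
  shows "((\<lambda>s. moment s b) has_real_derivative (s * logis b s)) (at s)"
proof -
  \<comment> \<open>The interval runs past \<open>s\<close>, which makes \<open>s\<close> an
    interior point and the derivative two-sided.\<close>
  have "((\<lambda>s. integral {0..s} (\<lambda>u. u * logis b u)) has_real_derivative (s * logis b s)) (at s within {0..s+1})"
    using assms by (intro integral_has_real_derivative continuous_intros) auto
  then have "((\<lambda>s. integral {0..s} (\<lambda>u. u * logis b u)) has_real_derivative (s * logis b s)) (at s)"
    using assms by (subst (asm) at_within_interior) auto
  then show ?thesis by (simp add: moment_def)
qed

text \<open>Monotonicity in the tilt turns \<open>a < beta s\<close> into
  \<open>moment s a > 1\<close>. This is an open condition on \<open>s\<close> for fixed
  \<open>a\<close>, since the moment is continuous in its upper limit; likewise for the other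
  inequality.\<close>

lemma beta_isCont:
  assumes t: "t > sqrt 2" shows "isCont beta t"
proof -
  have t0: "t > 0" using t real_sqrt_gt_zero[of 2] by linarith
  have cont: "(\<lambda>s. moment s b) \<midarrow>t\<rightarrow> moment t b" for b
    using moment_deriv_upper[OF t0, of b] DERIV_isCont isCont_def by blast
  have gt: "\<forall>\<^sub>F s in at t. s > sqrt 2"
    using t by (simp add: eventually_at_topological) (metis open_greaterThan greaterThan_iff)
  have "(beta \<longlongrightarrow> beta t) (at t)"
  proof (rule order_tendstoI)
    fix a assume "a < beta t"
    then have "moment t a > 1" using moment_strict_antimono[OF t0] moment_beta[OF t] by metis
    then have "\<forall>\<^sub>F s in at t. moment s a > 1" using cont order_tendstoD(1) by blast
    with gt show "\<forall>\<^sub>F s in at t. a < beta s"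
    proof eventually_elim
      case (elim s)
      then have s0: "s > 0" using real_sqrt_gt_zero[of 2] by linarith
      show ?case
        using elim moment_beta[of s] moment_strict_antimono[OF s0, of "beta s" a]
        by (cases "beta s" a rule: linorder_cases) auto
    qed
  next
    fix a assume "beta t < a"
    then have "moment t a < 1" using moment_strict_antimono[OF t0] moment_beta[OF t] by metis
    then have "\<forall>\<^sub>F s in at t. moment s a < 1" using cont order_tendstoD(2) by blast
    with gt show "\<forall>\<^sub>F s in at t. beta s < a"
    proof eventually_elim
      case (elim s)
      then have s0: "s > 0" using real_sqrt_gt_zero[of 2] by linarith
      show ?case
        using elim moment_beta[of s] moment_strict_antimono[OF s0, of a "beta s"]
        by (cases "beta s" a rule: linorder_cases) auto
    qed
  qed
  then show ?thesis by (simp add: isCont_def)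
qed

text \<open>Implicit differentiation of \<open>moment s (beta s) = 1\<close>, done by hand: the
  increment is split into a change of \<open>s\<close> at the tilt \<open>beta s\<close> and a
  change of the tilt at the fixed upper limit \<open>t\<close>.\<close>

lemma beta_deriv:
  assumes t: "t > sqrt 2"
  shows "(beta has_real_derivative (t * logis (beta t) t / limit_var t (beta t))) (at t)"
proof -
  have t0: "t > 0" using t real_sqrt_gt_zero[of 2] by linarith
  define V where "V = limit_var t (beta t)"
  have V: "V > 0" unfolding V_def by (rule limit_var_pos[OF t0])
  \<comment> \<open>Caratheodory's form of the derivative: \<open>g\<close> is a difference quotient
    that remains defined at \<open>beta t\<close>, and continuity of \<open>beta\<close> gives the
    limit of \<open>g (beta s)\<close>.\<close>
  obtain g where g: "\<And>z. moment t z - moment t (beta t) = g z * (z - beta t)"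
    and cont_g: "isCont g (beta t)" and g0: "g (beta t) = - V"
    using moment_deriv[of t "beta t"] unfolding CARAT_DERIV V_def by blast
  have lim_beta: "(beta \<longlongrightarrow> beta t) (at t)"
    using beta_isCont[OF t] by (simp add: isCont_def)
  have lim_g: "((\<lambda>s. g (beta s)) \<longlongrightarrow> - V) (at t)"
    using isCont_tendsto_compose[OF cont_g lim_beta] g0 by simp
  have gt: "\<forall>\<^sub>F s in at t. s > sqrt 2"
    using t by (simp add: eventually_at_topological) (metis open_greaterThan greaterThan_iff)
  \<comment> \<open>Mean value theorem in the upper limit. The tilt is left arbitrary because it
    will be \<open>beta s\<close>, which moves with \<open>s\<close>.\<close>
  have "\<exists>\<eta>. \<bar>\<eta> - t\<bar> \<le> \<bar>s - t\<bar> \<and> moment s b - moment t b = (s - t) * (\<eta> * logis b \<eta>)"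
    if "s > 0" for s b
  proof (cases s t rule: linorder_cases)
    case less
    then obtain z where "s < z" "z < t" "moment t b - moment s b = (t - s) * (z * logis b z)"
      using MVT2[of s t "\<lambda>s. moment s b" "\<lambda>z. z * logis b z"] moment_deriv_upper \<open>s > 0\<close> by force
    then show ?thesis by (intro exI[of _ z]) (auto simp: algebra_simps)
  next
    case greater
    then obtain z where "t < z" "z < s" "moment s b - moment t b = (s - t) * (z * logis b z)"
      using MVT2[of t s "\<lambda>s. moment s b" "\<lambda>z. z * logis b z"] moment_deriv_upper t0 by force
    then show ?thesis by (intro exI[of _ z]) auto
  qed (auto intro: exI[of _ t])
  then obtain \<eta> where \<eta>: "\<And>s b. s > 0 \<Longrightarrow> \<bar>\<eta> s b - t\<bar> \<le> \<bar>s - t\<bar>"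
    "\<And>s b. s > 0 \<Longrightarrow> moment s b - moment t b = (s - t) * (\<eta> s b * logis b (\<eta> s b))"
    by metis
  define h where "h s = \<eta> s (beta s) * logis (beta s) (\<eta> s (beta s))" for s
  have lim_eta: "((\<lambda>s. \<eta> s (beta s)) \<longlongrightarrow> t) (at t)"
  proof (rule LIM_zero_cancel, rule Lim_null_comparison)
    show "\<forall>\<^sub>F s in at t. norm (\<eta> s (beta s) - t) \<le> \<bar>s - t\<bar>"
      using gt proof eventually_elim
      case (elim s)
      then have "s > 0" using real_sqrt_gt_zero[of 2] by linarith
      then show ?case using \<eta>(1) by simp
    qed
    show "((\<lambda>s. \<bar>s - t\<bar>) \<longlongrightarrow> 0) (at t)"
      by (auto intro!: tendsto_eq_intros)
  qed
  have lim_h: "(h \<longlongrightarrow> t * logis (beta t) t) (at t)"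
    unfolding h_def logis_def by (intro tendsto_intros lim_eta lim_beta) auto
  have "((\<lambda>s. - (h s / g (beta s))) \<longlongrightarrow> - (t * logis (beta t) t / - V)) (at t)"
    using V by (intro tendsto_intros lim_h lim_g) auto
  moreover have "\<forall>\<^sub>F s in at t. (beta s - beta t) / (s - t) = - (h s / g (beta s))"
  proof -
    have "\<forall>\<^sub>F s in at t. g (beta s) < 0"
      using lim_g V by (intro order_tendstoD(2)) auto
    moreover have "\<forall>\<^sub>F s in at t. s \<noteq> t" by (simp add: eventually_at_filter)
    ultimately show ?thesis using gt
    proof eventually_elim
      case (elim s)
      have s0: "s > 0" using elim real_sqrt_gt_zero[of 2] by linarith
      \<comment> \<open>Both moments equal 1, so the two partial increments cancel; solving for the
        quotient gives the derivative.\<close>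
      have "(s - t) * h s + g (beta s) * (beta s - beta t) = 0"
        using \<eta>(2)[OF s0, of "beta s"] g[of "beta s"] moment_beta[OF t] moment_beta[of s] elim
        by (simp add: h_def)
      then show ?case using elim by (simp add: field_simps)
    qed
  qed
  ultimately have "((\<lambda>s. (beta s - beta t) / (s - t)) \<longlongrightarrow> - (t * logis (beta t) t / - V)) (at t)"
    using tendsto_cong by force
  then show ?thesis by (simp add: has_field_derivative_iff V_def)
qed

section \<open>Riemann sums to second order\<close>

locale smooth_on_interval =
  fixes F f f' f'' :: "real \<Rightarrow> real" and t M1 M2 :: real
  assumes t_pos: "t > 0"
    and F_deriv: "\<And>x. 0 \<le> x \<Longrightarrow> x \<le> t \<Longrightarrow> (F has_real_derivative f x) (at x)"
    and f_deriv: "\<And>x. 0 \<le> x \<Longrightarrow> x \<le> t \<Longrightarrow> (f has_real_derivative f' x) (at x)"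
    and f'_deriv: "\<And>x. 0 \<le> x \<Longrightarrow> x \<le> t \<Longrightarrow> (f' has_real_derivative f'' x) (at x)"
    and f'_bound: "\<And>x. 0 \<le> x \<Longrightarrow> x \<le> t \<Longrightarrow> \<bar>f' x\<bar> \<le> M1"
    and f''_bound: "\<And>x. 0 \<le> x \<Longrightarrow> x \<le> t \<Longrightarrow> \<bar>f'' x\<bar> \<le> M2"
begin

lemma M_nonneg: "0 \<le> M1" "0 \<le> M2"
  using f'_bound[of 0] f''_bound[of 0] t_pos by auto

lemma f_lipschitz:
  assumes "0 \<le> x" "x \<le> y" "y \<le> t"
  shows "\<bar>f y - f x\<bar> \<le> M1 * (y - x)"
proof (cases "x = y")
  case False
  then obtain z where z: "x < z" "z < y" "f y - f x = (y - x) * f' z"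
    using MVT2[of x y f f'] f_deriv assms by force
  then show ?thesis
    using f'_bound[of z] assms by (simp add: abs_mult mult.commute mult_left_mono)
qed auto

text \<open>First-order expansion at the right endpoint. It accounts for the piece between the last
  grid point and \<open>t\<close>.\<close>

lemma F_taylor:
  assumes "0 \<le> x" "x \<le> t"
  shows "\<bar>F t - F x - (t - x) * f t\<bar> \<le> M1 * (t - x)\<^sup>2"
proof (cases "x = t")
  case False
  then obtain z where z: "x < z" "z < t" "F t - F x = (t - x) * f z"
    using MVT2[of x t F f] F_deriv assms by force
  have "\<bar>f t - f z\<bar> \<le> M1 * (t - z)"
    using z assms by (intro f_lipschitz) auto
  also have "\<dots> \<le> M1 * (t - x)"
    using z M_nonneg by (intro mult_left_mono) auto
  finally have "(t - x) * \<bar>f t - f z\<bar> \<le> (t - x) * (M1 * (t - x))"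
    using assms by (intro mult_left_mono) auto
  moreover have "F t - F x - (t - x) * f t = - ((t - x) * (f t - f z))"
    by (simp add: z(3) algebra_simps)
  ultimately show ?thesis
    using assms by (simp add: abs_mult power2_eq_square mult_ac)
qed auto

text \<open>The error \<open>D\<close>, viewed as a function of the step, vanishes at 0 and has a
  derivative of order \<open>h^2\<close>; the mean value theorem supplies the third power.\<close>

lemma trapezoid_interval:
  assumes "0 \<le> a" "0 < h" "a + h \<le> t"
  shows "\<bar>F (a + h) - F a - h * (f a + f (a + h)) / 2\<bar> \<le> M2 * h ^ 3 / 2"
proof -
  define D where "D x = F (a + x) - F a - x * (f a + f (a + x)) / 2" for x
  define D' where "D' x = f (a + x) - (f a + f (a + x)) / 2 - x * f' (a + x) / 2" for x
  have D_deriv: "(D has_real_derivative D' x) (at x)" if "0 \<le> x" "x \<le> h" for x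
  proof -
    have [derivative_intros]: "((\<lambda>x. F (a + x)) has_real_derivative f (a + x)) (at x)"
      "((\<lambda>x. f (a + x)) has_real_derivative f' (a + x)) (at x)"
      using that assms F_deriv[of "a + x"] f_deriv[of "a + x"]
      by (simp_all add: DERIV_shift add.commute[of a])
    show ?thesis unfolding D_def D'_def
      by (rule derivative_eq_intros refl | simp)+ (simp add: field_simps)
  qed
  then obtain z where z: "0 < z" "z < h" "D h - D 0 = (h - 0) * D' z"
    using MVT2[of 0 h D D'] assms by auto
  obtain w where w: "a < w" "w < a + z" "f (a + z) - f a = (a + z - a) * f' w"
    using MVT2[of a "a + z" f f'] z assms f_deriv by force
  obtain v where v: "w < v" "v < a + z" "f' (a + z) - f' w = (a + z - w) * f'' v"
    using MVT2[of w "a + z" f' f''] w z assms f'_deriv by force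
  \<comment> \<open>Writing the increment of \<open>f\<close> as \<open>z * f' w\<close> leaves only
    a difference of two values of \<open>f'\<close>, which a further mean value theorem bounds
    through \<open>f''\<close>.\<close>
  have "D' z = - (z * (f' (a + z) - f' w) / 2)"
    using w(3) by (simp add: D'_def field_simps)
  then have "\<bar>D' z\<bar> = z * ((a + z - w) * \<bar>f'' v\<bar>) / 2"
    using z w v by (simp add: abs_mult)
  also have "\<dots> \<le> h * (h * M2) / 2"
    using z w v assms f''_bound[of v] by (intro divide_right_mono mult_mono) auto
  finally have "h * \<bar>D' z\<bar> \<le> h * (h * (h * M2) / 2)"
    using assms by (intro mult_left_mono) auto
  moreover have "D h = h * D' z" using z(3) by (simp add: D_def)
  ultimately have "\<bar>D h\<bar> \<le> M2 * h ^ 3 / 2"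
    using assms by (simp add: abs_mult power3_eq_cube mult_ac)
  then show ?thesis by (simp add: D_def)
qed

text \<open>The sum over right endpoints exceeds the trapezoidal sum by
  \<open>h * (f (real N * h) - f 0) / 2\<close>, and the local errors add up.\<close>

lemma trapezoid_sum:
  assumes "0 < h" "real N * h \<le> t"
  shows "\<bar>h * (\<Sum>k=1..N. f (real k * h)) - (F (real N * h) - F 0) - h * (f (real N * h) - f 0) / 2\<bar>
           \<le> real N * (M2 * h ^ 3 / 2)"
  using assms(2)
proof (induction N)
  case (Suc N)
  have le: "real N * h + h \<le> t" using Suc.prems by (simp add: algebra_simps)
  define X where "X = h * (\<Sum>k=1..N. f (real k * h)) - (F (real N * h) - F 0)
      - h * (f (real N * h) - f 0) / 2"
  define Y where "Y = F (real N * h + h) - F (real N * h)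
      - h * (f (real N * h) + f (real N * h + h)) / 2"
  have Y: "\<bar>Y\<bar> \<le> M2 * h ^ 3 / 2"
    unfolding Y_def using assms(1) le by (intro trapezoid_interval) auto
  have X: "\<bar>X\<bar> \<le> real N * (M2 * h ^ 3 / 2)"
    unfolding X_def using Suc.IH le assms(1) by simp
  have eq: "real (Suc N) * h = real N * h + h" by (simp add: algebra_simps)
  have "h * (\<Sum>k=1..Suc N. f (real k * h)) - (F (real (Suc N) * h) - F 0)
      - h * (f (real (Suc N) * h) - f 0) / 2 = X - Y"
    unfolding sum.cl_ivl_Suc eq X_def Y_def
    by (simp add: eq field_simps del: of_nat_Suc)
  moreover have "\<bar>X - Y\<bar> \<le> real (Suc N) * (M2 * h ^ 3 / 2)"
    using X Y abs_triangle_ineq4[of X Y] by (simp add: algebra_simps)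
  ultimately show ?case by metis
qed auto

text \<open>With \<open>h = 1 / sqrt n\<close>, the grid stops at \<open>y = t - r * h\<close>,
  where \<open>r\<close> is the fractional part of \<open>t * sqrt n\<close>. After multiplication
  by \<open>h\<close> all errors are of order \<open>h^2\<close>: the trapezoidal error, the
  expansion of \<open>F\<close> on \<open>[y, t]\<close>, and the replacement of \<open>f y\<close>
  by \<open>f t\<close>.\<close>

lemma euler_maclaurin:
  "(\<lambda>n. (\<Sum>k=1..nat \<lfloor>t * sqrt (real n)\<rfloor>. f (real k / sqrt (real n)))
      - (sqrt (real n) * (F t - F 0) - frac (t * sqrt (real n)) * f t + (f t - f 0) / 2)) \<longlonglongrightarrow> 0"
proof (rule Lim_null_comparison)
  show "(\<lambda>n. (M2 * t / 2 + 2 * M1) * (1 / sqrt (real n))) \<longlonglongrightarrow> 0"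
    by (intro tendsto_mult_right_zero tendsto_divide_0[OF tendsto_const] filterlim_at_top_imp_at_infinity
        filterlim_compose[OF sqrt_at_top] filterlim_real_sequentially)
  show "\<forall>\<^sub>F n in sequentially. norm ((\<Sum>k=1..nat \<lfloor>t * sqrt (real n)\<rfloor>. f (real k / sqrt (real n)))
      - (sqrt (real n) * (F t - F 0) - frac (t * sqrt (real n)) * f t + (f t - f 0) / 2))
      \<le> (M2 * t / 2 + 2 * M1) * (1 / sqrt (real n))"
    using eventually_gt_at_top[of 0]
  proof eventually_elim
    case (elim n)
    define h where "h = 1 / sqrt (real n)"
    define N where "N = nat \<lfloor>t * sqrt (real n)\<rfloor>"
    define r where "r = frac (t * sqrt (real n))"
    define y where "y = real N * h"
    define S where "S = (\<Sum>k=1..N. f (real k * h))"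
    have h: "h > 0" using elim by (simp add: h_def)
    have sq: "sqrt (real n) = 1 / h" by (simp add: h_def)
    have N: "real N = t * sqrt (real n) - r"
      using t_pos by (simp add: N_def r_def frac_def)
    have r: "0 \<le> r" "r < 1" by (simp_all add: r_def frac_ge_0 frac_lt_1)
    have y: "t - y = r * h" using h by (simp add: y_def N sq field_simps)
    have y01: "0 \<le> y" "y \<le> t" using y r h by (simp add: y_def, smt (verit) mult_nonneg_nonneg)
    have yh: "t - y \<le> h" using y r h by (simp add: mult_left_le_one_le)
    have 1: "\<bar>h * S - (F y - F 0) - h * (f y - f 0) / 2\<bar> \<le> real N * (M2 * h ^ 3 / 2)"
      unfolding S_def y_def using h y01 by (intro trapezoid_sum) (auto simp: y_def)
    have "real N * (M2 * h ^ 3 / 2) = y * (M2 * h\<^sup>2 / 2)"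
      by (simp add: y_def power2_eq_square power3_eq_cube)
    also have "\<dots> \<le> t * (M2 * h\<^sup>2 / 2)"
      using y01 M_nonneg by (intro mult_right_mono) auto
    finally have 1: "\<bar>h * S - (F y - F 0) - h * (f y - f 0) / 2\<bar> \<le> t * (M2 * h\<^sup>2 / 2)"
      using 1 by simp
    have "M1 * (t - y)\<^sup>2 \<le> M1 * h\<^sup>2"
      using y01 yh M_nonneg by (intro mult_left_mono power_mono) auto
    then have 2: "\<bar>F t - F y - (t - y) * f t\<bar> \<le> M1 * h\<^sup>2"
      using F_taylor[OF y01] by linarith
    have "\<bar>f t - f y\<bar> \<le> M1 * (t - y)" using y01 by (intro f_lipschitz) auto
    also have "\<dots> \<le> M1 * h" using yh M_nonneg by (intro mult_left_mono)
    finally have "h * \<bar>f t - f y\<bar> \<le> h * (M1 * h)" using h by (intro mult_left_mono) auto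
    then have 3: "\<bar>h * f t - h * f y\<bar> \<le> M1 * h\<^sup>2"
      using h by (simp add: abs_mult power2_eq_square mult_ac flip: right_diff_distrib)
    define E where "E = S - (sqrt (real n) * (F t - F 0) - r * f t + (f t - f 0) / 2)"
    \<comment> \<open>The three groups are exactly the quantities bounded in \<open>1\<close>,
      \<open>2\<close> and \<open>3\<close>.\<close>
    have "h * E = (h * S - (F y - F 0) - h * (f y - f 0) / 2) - (F t - F y - (t - y) * f t)
        - (h * f t - h * f y) / 2"
      using h by (simp add: E_def y sq algebra_simps) (simp add: field_simps)
    moreover have "\<bar>a - b - c / 2\<bar> \<le> \<bar>a\<bar> + \<bar>b\<bar> + \<bar>c\<bar>" for a b c :: real by linarith
    ultimately have "\<bar>h * E\<bar> \<le> \<bar>h * S - (F y - F 0) - h * (f y - f 0) / 2\<bar>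
        + \<bar>F t - F y - (t - y) * f t\<bar> + \<bar>h * f t - h * f y\<bar>"
      by presburger
    also have "\<dots> \<le> t * (M2 * h\<^sup>2 / 2) + M1 * h\<^sup>2 + M1 * h\<^sup>2"
      by (intro add_mono 1 2 3)
    finally have "\<bar>h * E\<bar> \<le> t * (M2 * h\<^sup>2 / 2) + M1 * h\<^sup>2 + M1 * h\<^sup>2" .
    then have "h * \<bar>E\<bar> \<le> h * ((M2 * t / 2 + 2 * M1) * h)"
      using h by (simp add: abs_mult power2_eq_square algebra_simps)
    then have "\<bar>E\<bar> \<le> (M2 * t / 2 + 2 * M1) * h"
      using h by simp
    then show ?case
      by (simp add: E_def S_def N_def r_def h_def)
  qed
qed

end

lemma sum_asymptotics:
  fixes f f' f'' :: "real \<Rightarrow> real"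
  assumes t: "t > 0"
    and f_deriv: "\<And>x. (f has_real_derivative f' x) (at x)"
    and f'_deriv: "\<And>x. (f' has_real_derivative f'' x) (at x)"
    and f''_cont: "continuous_on {0..t} f''"
    and int: "(f has_integral I) {0..t}"
  shows "(\<lambda>n. (\<Sum>k=1..nat \<lfloor>t * sqrt (real n)\<rfloor>. f (real k / sqrt (real n)))
      - (sqrt (real n) * I - frac (t * sqrt (real n)) * f t + (f t - f 0) / 2)) \<longlonglongrightarrow> 0"
proof -
  \<comment> \<open>Starting the integral at -1 makes 0 an interior point, so that \<open>F\<close>
    has a two-sided derivative there too.\<close>
  define F where "F x = integral {-1..x} f" for x
  have cont: "continuous_on A f" "continuous_on A f'" for A
    using f_deriv f'_deriv by (auto intro!: continuous_at_imp_continuous_on DERIV_isCont)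
  have F_deriv: "(F has_real_derivative f x) (at x)" if "0 \<le> x" "x \<le> t" for x
  proof -
    have "(F has_real_derivative f x) (at x within {-1..t+1})"
      unfolding F_def using that by (intro integral_has_real_derivative cont) auto
    then show ?thesis using that by (subst (asm) at_within_interior) auto
  qed
  have "(f has_integral (F t - F 0)) {0..t}"
    using t F_deriv
    by (intro fundamental_theorem_of_calculus)
      (auto simp: has_real_derivative_iff_has_vector_derivative[symmetric] intro: has_field_derivative_at_within)
  then have I: "I = F t - F 0" using int has_integral_unique by blast
  have bdd: "\<exists>M. \<forall>x\<in>{0..t}. \<bar>g x\<bar> \<le> M" if "continuous_on {0..t} g" for g :: "real \<Rightarrow> real"
    using compact_imp_bounded[OF compact_continuous_image[OF that compact_Icc]]
    by (auto simp: bounded_iff)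
  obtain M1 M2 where "\<forall>x\<in>{0..t}. \<bar>f' x\<bar> \<le> M1" "\<forall>x\<in>{0..t}. \<bar>f'' x\<bar> \<le> M2"
    using bdd[OF cont(2)] bdd[OF f''_cont] by blast
  then interpret smooth_on_interval F f f' f'' t M1 M2
    using t F_deriv f_deriv f'_deriv by unfold_locales auto
  show ?thesis using euler_maclaurin by (simp add: I)
qed

text \<open>The second-order terms are bounded, so any divisor \<open>g\<close> tending to infinity
  removes them. The mean and the variance of the tilted sum need only this accuracy.\<close>

lemma sum_asymptotics_leading:
  fixes f f' f'' :: "real \<Rightarrow> real" and g :: "nat \<Rightarrow> real"
  assumes t: "t > 0"
    and f_deriv: "\<And>x. (f has_real_derivative f' x) (at x)"
    and f'_deriv: "\<And>x. (f' has_real_derivative f'' x) (at x)"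
    and f''_cont: "continuous_on {0..t} f''"
    and int: "(f has_integral I) {0..t}"
    and g: "filterlim g at_top sequentially"
  shows "(\<lambda>n. ((\<Sum>k=1..nat \<lfloor>t * sqrt (real n)\<rfloor>. f (real k / sqrt (real n))) - sqrt (real n) * I) / g n)
           \<longlonglongrightarrow> 0"
proof -
  define S where "S n = (\<Sum>k=1..nat \<lfloor>t * sqrt (real n)\<rfloor>. f (real k / sqrt (real n)))" for n :: nat
  define c where "c = (f t - f 0) / 2"
  define r where "r n = frac (t * sqrt (real n))" for n :: nat
  define E where "E n = S n - (sqrt (real n) * I - r n * f t + c)" for n
  have ginf: "filterlim g at_infinity sequentially"
    using g by (rule filterlim_at_top_imp_at_infinity)
  have E: "E \<longlonglongrightarrow> 0"
    unfolding E_def S_def c_def r_def by (rule sum_asymptotics[OF assms(1-5)])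
  have "(\<lambda>n. r n * f t / g n) \<longlonglongrightarrow> 0"
  proof (rule Lim_null_comparison)
    show "\<forall>\<^sub>F n in sequentially. norm (r n * f t / g n) \<le> \<bar>f t / g n\<bar>"
      by (intro always_eventually allI)
        (simp add: abs_mult r_def mult_left_le_one_le divide_right_mono frac_ge_0 less_imp_le[OF frac_lt_1])
    show "(\<lambda>n. \<bar>f t / g n\<bar>) \<longlonglongrightarrow> 0"
      by (intro tendsto_rabs_zero tendsto_divide_0[OF tendsto_const ginf])
  qed
  then have "(\<lambda>n. E n / g n - r n * f t / g n + c / g n) \<longlonglongrightarrow> 0 - 0 + 0"
    by (intro tendsto_add tendsto_diff tendsto_divide_0[OF E ginf] tendsto_divide_0[OF tendsto_const ginf])
  moreover have "E n / g n - r n * f t / g n + c / g n = (S n - sqrt (real n) * I) / g n" for n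
    by (simp add: E_def add_divide_distrib diff_divide_distrib)
  ultimately show ?thesis by (simp add: S_def)
qed

section \<open>Characteristic functions of Bernoulli variables\<close>

lemma jordan_sin:
  fixes x :: real
  assumes "0 \<le> x" "x \<le> pi / 2"
  shows "2 * x / pi \<le> sin x"
proof -
  \<comment> \<open>Concavity of the sine: on \<open>[0, pi / 2]\<close> it lies above its
    chord.\<close>
  have "convex_on {0..pi} (\<lambda>x. - sin x :: real)"
    by (rule f''_ge0_imp_convex[where f' = "\<lambda>x. - cos x" and f'' = sin])
      (auto intro!: derivative_eq_intros sin_ge_zero)
  from convex_onD[OF this, of "2 * x / pi" 0 "pi / 2"] show ?thesis
    using assms by simp
qed

lemma one_minus_cos_ge:
  fixes y :: real
  assumes "\<bar>y\<bar> \<le> pi"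
  shows "2 * y\<^sup>2 / pi\<^sup>2 \<le> 1 - cos y"
proof -
  have "\<bar>y\<bar> / pi \<le> sin (\<bar>y\<bar> / 2)"
    using jordan_sin[of "\<bar>y\<bar> / 2"] assms by simp
  then have "(\<bar>y\<bar> / pi)\<^sup>2 \<le> (sin (\<bar>y\<bar> / 2))\<^sup>2"
    by (intro power_mono) auto
  moreover have "cos \<bar>y\<bar> = 1 - 2 * (sin (\<bar>y\<bar> / 2))\<^sup>2"
    using cos_double_sin[of "\<bar>y\<bar> / 2"] by simp
  ultimately show ?thesis by (simp add: power_divide)
qed

text \<open>The Dirichlet kernel, with its denominator multiplied out so that zeros of the sine
  cause no trouble.\<close>

lemma sum_cos_telescope:
  fixes \<theta> :: real
  shows "2 * sin (\<theta> / 2) * (\<Sum>k=1..N. cos (real k * \<theta>)) = sin (real N * \<theta> + \<theta> / 2) - sin (\<theta> / 2)"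
proof (induction N)
  case (Suc N)
  have "sin (real (Suc N) * \<theta> + \<theta> / 2) - sin (real (Suc N) * \<theta> - \<theta> / 2)
      = 2 * sin (\<theta> / 2) * cos (real (Suc N) * \<theta>)"
    by (simp only: sin_add sin_diff) simp
  moreover have "real (Suc N) * \<theta> - \<theta> / 2 = real N * \<theta> + \<theta> / 2"
    by (simp add: field_simps)
  ultimately have "sin (real (Suc N) * \<theta> + \<theta> / 2) - sin (real N * \<theta> + \<theta> / 2)
      = 2 * sin (\<theta> / 2) * cos (real (Suc N) * \<theta>)" by metis
  then show ?case using Suc.IH by (simp add: distrib_left del: of_nat_Suc)
qed simp

text \<open>Every angle stays within \<open>[-pi, pi]\<close>, so the quadratic bound applies term
  by term; the sum of squares is at least \<open>N^3 / 3\<close>.\<close>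

lemma sum_one_minus_cos_ge_small:
  fixes \<theta> :: real
  assumes "real N * \<bar>\<theta>\<bar> \<le> pi"
  shows "2 * \<theta>\<^sup>2 / (3 * pi\<^sup>2) * real N ^ 3 \<le> (\<Sum>k=1..N. 1 - cos (real k * \<theta>))"
proof -
  have cube: "real N ^ 3 / 3 \<le> (\<Sum>k=1..N. (real k)\<^sup>2)" for N
    by (induction N) (auto simp: power2_eq_square power3_eq_cube algebra_simps)
  have "2 * \<theta>\<^sup>2 / (3 * pi\<^sup>2) * real N ^ 3 = 2 * \<theta>\<^sup>2 / pi\<^sup>2 * (real N ^ 3 / 3)" by simp
  also have "\<dots> \<le> 2 * \<theta>\<^sup>2 / pi\<^sup>2 * (\<Sum>k=1..N. (real k)\<^sup>2)"
    by (intro mult_left_mono cube) auto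
  also have "\<dots> = (\<Sum>k=1..N. 2 * (real k * \<theta>)\<^sup>2 / pi\<^sup>2)"
    by (simp add: sum_distrib_left sum_divide_distrib power_mult_distrib mult_ac)
  also have "\<dots> \<le> (\<Sum>k=1..N. 1 - cos (real k * \<theta>))"
  proof (intro sum_mono one_minus_cos_ge)
    fix k assume "k \<in> {1..N}"
    then have "real k * \<bar>\<theta>\<bar> \<le> real N * \<bar>\<theta>\<bar>" by (intro mult_right_mono) auto
    then show "\<bar>real k * \<theta>\<bar> \<le> pi" using assms by (simp add: abs_mult)
  qed
  finally show ?thesis .
qed

text \<open>Here the cosines cancel: \<open>sin (\<phi> / 2) >= 1 / N\<close> by Jordan's
  inequality, so the Dirichlet kernel bounds their sum by \<open>N / 2\<close>.\<close>

lemma sum_one_minus_cos_ge_large: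
  fixes \<theta> :: real
  assumes "pi \<le> real N * \<bar>\<theta>\<bar>" "\<bar>\<theta>\<bar> \<le> pi"
  shows "real N / 2 \<le> (\<Sum>k=1..N. 1 - cos (real k * \<theta>))"
proof -
  define \<phi> where "\<phi> = \<bar>\<theta>\<bar>"
  have N: "real N > 0" using assms(1) pi_gt_zero by (cases N) auto
  have \<phi>: "\<phi> > 0"
  proof (rule ccontr)
    assume "\<not> \<phi> > 0"
    then have "pi \<le> 0" using assms(1) by (simp add: \<phi>_def)
    then show False using pi_gt_zero by linarith
  qed
  have "cos (real k * \<theta>) = cos (real k * \<phi>)" for k
    unfolding \<phi>_def by (cases "\<theta> \<ge> 0") auto
  then have eq: "(\<Sum>k=1..N. 1 - cos (real k * \<theta>)) = real N - (\<Sum>k=1..N. cos (real k * \<phi>))"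
    by (simp add: sum_subtractf)
  have "1 / real N \<le> \<phi> / pi"
    using assms N by (simp add: \<phi>_def field_simps)
  also have "\<dots> \<le> sin (\<phi> / 2)"
    using jordan_sin[of "\<phi> / 2"] \<phi> assms by (simp add: \<phi>_def)
  finally have s: "1 / real N \<le> sin (\<phi> / 2)" .
  have s0: "sin (\<phi> / 2) > 0" using s N by (smt (verit) divide_pos_pos)
  have "2 * sin (\<phi> / 2) * (\<Sum>k=1..N. cos (real k * \<phi>)) \<le> 1"
    unfolding sum_cos_telescope using s0 sin_le_one[of "real N * \<phi> + \<phi> / 2"] by linarith
  also have "\<dots> \<le> 2 * sin (\<phi> / 2) * (real N / 2)"
    using s N by (simp add: field_simps)
  finally have "(\<Sum>k=1..N. cos (real k * \<phi>)) \<le> real N / 2"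
    using s0 by simp
  then show ?thesis unfolding eq by simp
qed

text \<open>The squared modulus is exactly \<open>1 - 2 * p * (1 - p) * (1 - cos \<alpha>)\<close>,
  and \<open>1 + x <= exp x\<close>.\<close>

lemma cmod_bernoulli_char_le:
  fixes p \<alpha> :: real
  shows "cmod (1 + of_real p * (iexp \<alpha> - 1)) \<le> exp (- (p * (1 - p) * (1 - cos \<alpha>)))"
proof -
  have "(cmod (1 + of_real p * (iexp \<alpha> - 1)))\<^sup>2 = (1 + p * (cos \<alpha> - 1))\<^sup>2 + (p * sin \<alpha>)\<^sup>2"
    by (simp add: cmod_power2 Re_exp Im_exp)
  also have "\<dots> = 1 + (- (2 * (p * (1 - p) * (1 - cos \<alpha>)))) + p\<^sup>2 * ((cos \<alpha>)\<^sup>2 + (sin \<alpha>)\<^sup>2 - 1)"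
    unfolding power2_eq_square by algebra
  also have "\<dots> = 1 + (- (2 * (p * (1 - p) * (1 - cos \<alpha>))))"
    by simp
  also have "\<dots> \<le> exp (- (2 * (p * (1 - p) * (1 - cos \<alpha>))))"
    by (rule exp_ge_add_one_self)
  also have "\<dots> = (exp (- (p * (1 - p) * (1 - cos \<alpha>))))\<^sup>2"
    by (simp flip: exp_double)
  finally show ?thesis
    by (rule power2_le_imp_le) simp
qed

lemma exp_minus_bound:
  fixes y :: real
  assumes "y \<ge> 0"
  shows "\<bar>exp (- y) - (1 - y)\<bar> \<le> y\<^sup>2"
proof -
  have "exp (- y) * (1 + y) \<le> exp (- y) * exp y"
    by (intro mult_left_mono exp_ge_add_one_self) auto
  then have "exp (- y) * (1 + y) \<le> 1" by (simp flip: exp_add)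
  then have "exp (- y) \<le> 1 / (1 + y)" using assms by (simp add: field_simps)
  also have "\<dots> \<le> 1 - y + y\<^sup>2"
  proof -
    have "1 \<le> (1 - y + y\<^sup>2) * (1 + y)" using assms by (simp add: algebra_simps power2_eq_square)
    then show ?thesis using assms by (simp add: field_simps)
  qed
  finally show ?thesis using exp_ge_add_one_self[of "- y"] by linarith
qed

text \<open>After centering, the two outcomes sit at \<open>- p\<close> and \<open>1 - p\<close>. In
  the quadratic Taylor polynomials the linear terms cancel and the quadratic ones give the variance;
  the remainders are cubic, and the Gaussian differs from its linearisation by a quartic
  term.\<close>

lemma centered_bernoulli_char_approx:
  fixes p \<alpha> :: real
  assumes p: "0 \<le> p" "p \<le> 1"
  shows "cmod ((1 + of_real p * (iexp \<alpha> - 1)) * iexp (- (p * \<alpha>))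
            - of_real (exp (- (p * (1 - p) * \<alpha>\<^sup>2 / 2)))) \<le> \<bar>\<alpha>\<bar> ^ 3 + \<alpha> ^ 4"
proof -
  define T where "T x = 1 + \<i> * of_real x - of_real (x\<^sup>2 / 2)" for x
  have T: "cmod (iexp x - T x) \<le> \<bar>x\<bar> ^ 3 / 6" for x
    using iexp_approx1[of x 2]
    by (simp add: T_def numeral_eq_Suc fact_numeral power_mult_distrib)
  have T': "cmod (iexp x - T x) \<le> \<bar>\<alpha>\<bar> ^ 3 / 6" if "\<bar>x\<bar> \<le> \<bar>\<alpha>\<bar>" for x
    using T[of x] power_mono[OF that, of 3] by linarith
  define y where "y = p * (1 - p) * \<alpha>\<^sup>2 / 2"
  have y0: "y \<ge> 0" using p by (simp add: y_def)
  have "p * (1 - p) / 2 \<le> 1"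
    using mult_mono[of p 1 "1 - p" 1] p by simp
  then have "y \<le> \<alpha>\<^sup>2"
    using mult_right_mono[of "p * (1 - p) / 2" 1 "\<alpha>\<^sup>2"] by (simp add: y_def)
  then have y2: "y\<^sup>2 \<le> \<alpha> ^ 4"
    using power_mono[of y "\<alpha>\<^sup>2" 2] y0 by simp
  have e1: "iexp \<alpha> * iexp (- (p * \<alpha>)) = iexp ((1 - p) * \<alpha>)"
    by (simp add: algebra_simps flip: exp_add)
  have "(1 + of_real p * (iexp \<alpha> - 1)) * iexp (- (p * \<alpha>))
      = (1 - of_real p) * iexp (- (p * \<alpha>)) + of_real p * (iexp \<alpha> * iexp (- (p * \<alpha>)))"
    by (simp add: algebra_simps)
  also have "\<dots> = of_real (1 - p) * iexp (- (p * \<alpha>)) + of_real p * iexp ((1 - p) * \<alpha>)"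
    unfolding e1 by simp
  finally have z: "(1 + of_real p * (iexp \<alpha> - 1)) * iexp (- (p * \<alpha>))
      = of_real (1 - p) * iexp (- (p * \<alpha>)) + of_real p * iexp ((1 - p) * \<alpha>)" .
  have "of_real (1 - p) * T (- (p * \<alpha>)) + of_real p * T ((1 - p) * \<alpha>) = of_real (1 - y)"
    by (simp add: T_def y_def complex_eq_iff) (simp add: field_simps power2_eq_square)
  then have "(1 + of_real p * (iexp \<alpha> - 1)) * iexp (- (p * \<alpha>)) - of_real (exp (- y))
     = of_real (1 - p) * (iexp (- (p * \<alpha>)) - T (- (p * \<alpha>)))
       + of_real p * (iexp ((1 - p) * \<alpha>) - T ((1 - p) * \<alpha>)) - of_real (exp (- y) - (1 - y))"
    unfolding z by (simp add: algebra_simps)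
  also have "cmod \<dots> \<le> cmod (of_real (1 - p) * (iexp (- (p * \<alpha>)) - T (- (p * \<alpha>))))
       + cmod (of_real p * (iexp ((1 - p) * \<alpha>) - T ((1 - p) * \<alpha>))) + cmod (of_real (exp (- y) - (1 - y)))"
    by (rule order_trans[OF norm_triangle_ineq4 add_right_mono[OF norm_triangle_ineq]])
  also have "\<dots> \<le> (1 - p) * (\<bar>\<alpha>\<bar> ^ 3 / 6) + p * (\<bar>\<alpha>\<bar> ^ 3 / 6) + y\<^sup>2"
  proof (intro add_mono)
    have "cmod (iexp (- (p * \<alpha>)) - T (- (p * \<alpha>))) \<le> \<bar>\<alpha>\<bar> ^ 3 / 6"
      using p by (intro T') (simp add: abs_mult mult_left_le_one_le)
    then show "cmod (of_real (1 - p) * (iexp (- (p * \<alpha>)) - T (- (p * \<alpha>)))) \<le> (1 - p) * (\<bar>\<alpha>\<bar> ^ 3 / 6)"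
      unfolding norm_mult norm_of_real using p by (intro mult_mono) auto
    have "cmod (iexp ((1 - p) * \<alpha>) - T ((1 - p) * \<alpha>)) \<le> \<bar>\<alpha>\<bar> ^ 3 / 6"
      using p by (intro T') (simp add: abs_mult mult_left_le_one_le)
    then show "cmod (of_real p * (iexp ((1 - p) * \<alpha>) - T ((1 - p) * \<alpha>))) \<le> p * (\<bar>\<alpha>\<bar> ^ 3 / 6)"
      unfolding norm_mult norm_of_real using p by (intro mult_mono) auto
    show "cmod (of_real (exp (- y) - (1 - y))) \<le> y\<^sup>2"
      unfolding norm_of_real using exp_minus_bound[OF y0] by simp
  qed
  also have "\<dots> \<le> \<bar>\<alpha>\<bar> ^ 3 + \<alpha> ^ 4"
  proof -
    have "(1 - p) * c + p * c = c" for c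
      by (simp add: algebra_simps)
    from this[of "\<bar>\<alpha>\<bar> ^ 3 / 6"] show ?thesis
      using y2 zero_le_power[OF abs_ge_zero[of \<alpha>], of 3] by linarith
  qed
  finally show ?thesis by (simp add: y_def)
qed

text \<open>All factors on both sides lie in the unit disc, so the difference of the products is at
  most the sum of the differences of the factors.\<close>

lemma cmod_prod_centered_bernoulli_le:
  fixes p :: "nat \<Rightarrow> real" and \<theta> :: real
  assumes p: "\<And>k. 0 \<le> p k" "\<And>k. p k \<le> 1"
  shows "cmod ((\<Prod>k=1..N. 1 + of_real (p k) * (iexp (real k * \<theta>) - 1))
               * iexp (- ((\<Sum>k=1..N. p k * real k) * \<theta>))
            - of_real (exp (- (\<theta>\<^sup>2 * (\<Sum>k=1..N. p k * (1 - p k) * (real k)\<^sup>2) / 2))))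
         \<le> real N * ((real N * \<bar>\<theta>\<bar>) ^ 3 + (real N * \<bar>\<theta>\<bar>) ^ 4)"
proof -
  define z where "z k = (1 + of_real (p k) * (iexp (real k * \<theta>) - 1)) * iexp (- (p k * (real k * \<theta>)))" for k
  define w where "w k = complex_of_real (exp (- (p k * (1 - p k) * (real k * \<theta>)\<^sup>2 / 2)))" for k
  have "(\<Prod>k=1..N. iexp (- (p k * (real k * \<theta>)))) = iexp (- ((\<Sum>k=1..N. p k * real k) * \<theta>))"
    by (simp add: sum_distrib_right mult.assoc sum_distrib_left flip: exp_sum sum_negf)
  then have z: "(\<Prod>k=1..N. z k) = (\<Prod>k=1..N. 1 + of_real (p k) * (iexp (real k * \<theta>) - 1))
               * iexp (- ((\<Sum>k=1..N. p k * real k) * \<theta>))"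
    by (simp only: z_def prod.distrib)
  have "(\<Prod>k=1..N. w k) = of_real (exp (\<Sum>k=1..N. - (p k * (1 - p k) * (real k * \<theta>)\<^sup>2 / 2)))"
    by (simp only: w_def exp_sum finite_atLeastAtMost of_real_prod)
  also have "(\<Sum>k=1..N. - (p k * (1 - p k) * (real k * \<theta>)\<^sup>2 / 2))
     = - (\<theta>\<^sup>2 * (\<Sum>k=1..N. p k * (1 - p k) * (real k)\<^sup>2) / 2)"
    by (simp add: sum_distrib_left sum_divide_distrib power_mult_distrib mult_ac flip: sum_negf)
  finally have w: "(\<Prod>k=1..N. w k) = of_real (exp (- (\<theta>\<^sup>2 * (\<Sum>k=1..N. p k * (1 - p k) * (real k)\<^sup>2) / 2)))" .
  have "cmod ((\<Prod>k=1..N. z k) - (\<Prod>k=1..N. w k)) \<le> (\<Sum>k=1..N. cmod (z k - w k))"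
  proof (rule norm_prod_diff)
    fix k
    have "exp (- (p k * (1 - p k) * (1 - cos (real k * \<theta>)))) \<le> 1"
      using p[of k] by simp
    then show "cmod (z k) \<le> 1"
      unfolding z_def norm_mult norm_exp_i_times mult_1_right
      using cmod_bernoulli_char_le[of "p k" "real k * \<theta>"] by (rule order_trans[rotated])
    show "cmod (w k) \<le> 1"
      using p[of k] by (simp add: w_def)
  qed
  also have "\<dots> \<le> (\<Sum>k=1..N. (real N * \<bar>\<theta>\<bar>) ^ 3 + (real N * \<bar>\<theta>\<bar>) ^ 4)"
  proof (rule sum_mono)
    fix k assume "k \<in> {1..N}"
    then have "\<bar>real k * \<theta>\<bar> \<le> real N * \<bar>\<theta>\<bar>" by (simp add: abs_mult mult_right_mono)
    then have "\<bar>real k * \<theta>\<bar> ^ 3 + \<bar>real k * \<theta>\<bar> ^ 4 \<le> (real N * \<bar>\<theta>\<bar>) ^ 3 + (real N * \<bar>\<theta>\<bar>) ^ 4"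
      by (intro add_mono power_mono) auto
    moreover have "cmod (z k - w k) \<le> \<bar>real k * \<theta>\<bar> ^ 3 + (real k * \<theta>) ^ 4"
      unfolding z_def w_def by (rule centered_bernoulli_char_approx[OF p])
    ultimately show "cmod (z k - w k) \<le> (real N * \<bar>\<theta>\<bar>) ^ 3 + (real N * \<bar>\<theta>\<bar>) ^ 4"
      by (simp add: power_even_abs)
  qed
  finally show ?thesis unfolding z w by simp
qed

section \<open>Integrals and derivatives of the summands\<close>

lemma first_moment_derivs:
  fixes b :: real
  defines "L \<equiv> logis b"
  shows "((\<lambda>u. u * L u) has_real_derivative L u - b * u * (L u * (1 - L u))) (at u)"
    and "((\<lambda>u. L u - b * u * (L u * (1 - L u))) has_real_derivative
          b\<^sup>2 * u * (L u * (1 - L u) * (1 - 2 * L u)) - 2 * b * (L u * (1 - L u))) (at u)"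
  unfolding L_def
  by (auto intro!: derivative_eq_intros simp: algebra_simps power2_eq_square)

lemma second_moment_derivs:
  fixes b :: real
  defines "L \<equiv> logis b"
  shows "((\<lambda>u. u\<^sup>2 * (L u * (1 - L u))) has_real_derivative
           2 * u * (L u * (1 - L u)) - b * u\<^sup>2 * (L u * (1 - L u) * (1 - 2 * L u))) (at u)"
    and "((\<lambda>u. 2 * u * (L u * (1 - L u)) - b * u\<^sup>2 * (L u * (1 - L u) * (1 - 2 * L u)))
           has_real_derivative
          2 * (L u * (1 - L u)) - 4 * b * u * (L u * (1 - L u) * (1 - 2 * L u))
            + b\<^sup>2 * u\<^sup>2 * (L u * (1 - L u) * (1 - 6 * L u + 6 * (L u)\<^sup>2))) (at u)"
  unfolding L_def
  by (auto intro!: derivative_eq_intros simp: algebra_simps power2_eq_square)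

lemma log_partition_deriv:
  "((\<lambda>u. ln (1 + exp (- b * u))) has_real_derivative - b * logis b u) (at u within A)"
  unfolding logis_def by (rule derivative_eq_intros refl | simp)+

text \<open>Integration by parts: differentiating \<open>u * ln (1 + exp (- b * u))\<close> produces
  the integrand minus \<open>b\<close> times the moment integrand.\<close>

lemma log_partition_has_integral:
  assumes "t \<ge> 0"
  shows "((\<lambda>u. ln (1 + exp (- b * u))) has_integral (t * ln (1 + exp (- b * t)) + b * moment t b)) {0..t}"
proof -
  have "((\<lambda>u. ln (1 + exp (- b * u)) - b * (u * logis b u)) has_integral
      (t * ln (1 + exp (- b * t)) - 0 * ln (1 + exp (- b * 0)))) {0..t}"
  proof (rule fundamental_theorem_of_calculus[OF assms])
    fix u
    show "((\<lambda>u. u * ln (1 + exp (- b * u))) has_vector_derivative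
        ln (1 + exp (- b * u)) - b * (u * logis b u)) (at u within {0..t})"
      using DERIV_mult[OF DERIV_ident log_partition_deriv[of b u]]
      by (simp add: has_real_derivative_iff_has_vector_derivative[symmetric] algebra_simps)
  qed
  from has_integral_add[OF this has_integral_mult_right[OF moment_has_integral[of b t], of b]]
  show ?thesis by simp
qed

text \<open>Orthogonality of characters over one period, stretched by \<open>R\<close> to match the
  scale at which \<open>Psi\<close> is evaluated.\<close>

lemma iexp_has_integral_period:
  fixes R :: real and j :: int
  assumes R: "R > 0"
  shows "((\<lambda>x. iexp (of_int j * (x / R))) has_integral (if j = 0 then of_real (2 * pi * R) else 0))
           {- (pi * R)..pi * R}"
proof (cases "j = 0")
  case True
  then show ?thesis
    using has_integral_const_real[of "1::complex" "- (pi * R)" "pi * R"] R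
    by (simp add: scaleR_conv_of_real mult_ac)
next
  case False
  define c where "c = \<i> * of_int j / of_real R"
  have c: "c \<noteq> 0" using False R by (simp add: c_def)
  define G where "G z = exp (c * z) / c" for z
  have "((\<lambda>x. exp (c * of_real x)) has_integral (G (of_real (pi * R)) - G (of_real (- (pi * R)))))
           {- (pi * R)..pi * R}"
  proof (rule fundamental_theorem_of_calculus)
    fix x
    have "(G has_field_derivative exp (c * of_real x)) (at (of_real x))"
      unfolding G_def using c by (auto intro!: derivative_eq_intros)
    then show "((\<lambda>x. G (of_real x)) has_vector_derivative exp (c * of_real x))
        (at x within {- (pi * R)..pi * R})"
      by (rule has_vector_derivative_real_field)
  qed (use R in auto)
  moreover have "G (of_real (pi * R)) = G (of_real (- (pi * R)))"
  proof -
    have "c * of_real (pi * R) = c * of_real (- (pi * R)) + (2 * of_int j * of_real pi) * \<i>"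
      using R by (simp add: c_def field_simps)
    then have "exp (c * of_real (pi * R)) = exp (c * of_real (- (pi * R))) * exp ((2 * of_int j * of_real pi) * \<i>)"
      by (simp only: exp_add)
    also have "exp ((2 * of_int j * of_real pi) * \<i>) = 1"
      using exp_integer_2pi[of "of_int j"] by simp
    finally show ?thesis by (simp add: G_def)
  qed
  ultimately show ?thesis using False by (simp add: c_def mult_ac)
qed

lemma gaussian_integral:
  assumes "V > 0"
  shows "integrable lborel (\<lambda>x::real. exp (- (V * x\<^sup>2 / 2)))"
    and "(LINT x|lborel. exp (- (V * x\<^sup>2 / 2))) = sqrt (2 * pi / V)"
proof -
  have eq: "exp (- (V * x\<^sup>2 / 2)) = sqrt (2 * pi / V) * normal_density 0 (1 / sqrt V) x" for x
    using assms by (simp add: normal_density_def power_divide field_simps)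
  show "integrable lborel (\<lambda>x::real. exp (- (V * x\<^sup>2 / 2)))"
    unfolding eq using assms by simp
  show "(LINT x|lborel. exp (- (V * x\<^sup>2 / 2))) = sqrt (2 * pi / V)"
    unfolding eq using assms by simp
qed

section \<open>Local limit theorem\<close>

locale saddle_point =
  fixes t b :: real
  assumes t_pos: "t > 0" and moment_eq_1: "moment t b = 1"
begin

text \<open>All powers of \<open>n\<close> below are powers of \<open>m n\<close>; the sum of the parts fluctuates on the scale
  \<open>m n ^ 3\<close> under the tilted measure.\<close>

definition m :: "nat \<Rightarrow> real" where "m n = real n powr (1 / 4)"

definition N :: "nat \<Rightarrow> nat" where "N n = nat \<lfloor>t * sqrt (real n)\<rfloor>"

definition p :: "nat \<Rightarrow> nat \<Rightarrow> real" where "p n k = logis b (real k / sqrt (real n))"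

definition V :: real where "V = limit_var t b"

text \<open>The partition function of the tilted measure: a set \<open>S\<close> of parts has
  probability \<open>exp (- b * (\<Sum>S / sqrt n)) / weight n\<close>.\<close>

definition weight :: "nat \<Rightarrow> real" where
  "weight n = (\<Prod>k=1..N n. 1 + exp (- b * (real k / sqrt (real n))))"

text \<open>The characteristic function of the tilted sum minus \<open>n\<close>, at \<open>x / m n ^ 3\<close>.\<close>

definition Psi :: "nat \<Rightarrow> real \<Rightarrow> complex" where
  "Psi n x = (\<Prod>k=1..N n. 1 + of_real (p n k) * (iexp (real k * (x / m n ^ 3)) - 1))
               * iexp (- (real n * (x / m n ^ 3)))"

lemma V_pos: "V > 0"
  unfolding V_def by (rule limit_var_pos[OF t_pos])

lemma m_power: "m n ^ 2 = sqrt (real n)" "m n ^ 4 = real n" "m n ^ 3 = real n powr (3 / 4)"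
proof -
  \<comment> \<open>At \<open>n = 0\<close> the exponent must be positive: \<open>0 ^ 0\<close> is 1
    whereas \<open>0 powr 0\<close> is 0.\<close>
  have "m n ^ k = real n powr (real k / 4)" if "k > 0" for k
    using that by (cases "n = 0") (simp_all add: m_def powr_powr flip: powr_realpow)
  from this[of 2] this[of 4] this[of 3]
  show "m n ^ 2 = sqrt (real n)" "m n ^ 4 = real n" "m n ^ 3 = real n powr (3 / 4)"
    by (simp_all add: powr_half_sqrt)
qed

lemma m_pos: "n > 0 \<Longrightarrow> m n > 0"
  by (simp add: m_def)

lemma m_at_top: "filterlim m at_top sequentially"
  unfolding m_def
  by (rule filterlim_compose[OF real_powr_at_top filterlim_real_sequentially]) simp

lemma N_le: "real (N n) \<le> t * m n ^ 2" and N_ge: "t * m n ^ 2 - 1 \<le> real (N n)"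
  using t_pos by (simp_all add: N_def m_power)

lemma p_bounds: "0 \<le> p n k" "p n k \<le> 1"
  using logis_pos logis_less_1 by (simp_all add: p_def less_imp_le)

text \<open>The defining equation of the saddle point enters here: the Riemann sum has integral 1,
  so the mean agrees with \<open>n\<close> up to \<open>o(m n ^ 3)\<close>. Dividing by
  \<open>m n ^ 2\<close> first reduces the claim to a divisor \<open>m n\<close>.\<close>

lemma mean_asymptotics: "(\<lambda>n. ((\<Sum>k=1..N n. p n k * real k) - real n) / m n ^ 3) \<longlonglongrightarrow> 0"
proof -
  have "(\<lambda>n. ((\<Sum>k=1..N n. real k / sqrt (real n) * logis b (real k / sqrt (real n))) - sqrt (real n) * 1) / m n)
      \<longlonglongrightarrow> 0"
    unfolding N_def
    by (rule sum_asymptotics_leading[OF t_pos first_moment_derivs _ _ m_at_top])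
      (use moment_has_integral[of b t] in \<open>auto simp: moment_eq_1 intro!: continuous_intros\<close>)
  moreover have "\<forall>\<^sub>F n in sequentially.
    ((\<Sum>k=1..N n. real k / sqrt (real n) * logis b (real k / sqrt (real n))) - sqrt (real n) * 1) / m n
     = ((\<Sum>k=1..N n. p n k * real k) - real n) / m n ^ 3"
    using eventually_gt_at_top[of 0]
  proof eventually_elim
    case (elim n)
    have "(\<Sum>k=1..N n. real k / sqrt (real n) * logis b (real k / sqrt (real n)))
        = (\<Sum>k=1..N n. p n k * real k) / m n ^ 2"
      by (simp add: p_def sum_divide_distrib m_power mult.commute)
    moreover have "real n = m n ^ 4" "sqrt (real n) = m n ^ 2" by (simp_all only: m_power)
    ultimately show ?case
      using m_pos[OF elim] by (simp add: field_simps power2_eq_square power3_eq_cube power4_eq_xxxx)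
  qed
  ultimately show ?thesis by (rule Lim_transform_eventually)
qed

lemma variance_asymptotics:
  "(\<lambda>n. (\<Sum>k=1..N n. p n k * (1 - p n k) * (real k)\<^sup>2) / m n ^ 6) \<longlonglongrightarrow> V"
proof -
  define S where "S n = (\<Sum>k=1..N n. (real k / sqrt (real n))\<^sup>2 *
    (logis b (real k / sqrt (real n)) * (1 - logis b (real k / sqrt (real n)))))" for n
  have sq: "filterlim (\<lambda>n. sqrt (real n)) at_top sequentially"
    by (rule filterlim_compose[OF sqrt_at_top filterlim_real_sequentially])
  have "(\<lambda>n. (S n - sqrt (real n) * V) / sqrt (real n)) \<longlonglongrightarrow> 0"
    unfolding N_def S_def
    by (rule sum_asymptotics_leading[OF t_pos second_moment_derivs _ _ sq])
      (use limit_var_has_integral[of b t] in \<open>auto simp: V_def intro!: continuous_intros\<close>)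
  then have "(\<lambda>n. (S n - sqrt (real n) * V) / sqrt (real n) + V) \<longlonglongrightarrow> 0 + V"
    by (intro tendsto_intros)
  moreover have "\<forall>\<^sub>F n in sequentially. (S n - sqrt (real n) * V) / sqrt (real n) + V
     = (\<Sum>k=1..N n. p n k * (1 - p n k) * (real k)\<^sup>2) / m n ^ 6"
    using eventually_gt_at_top[of 0]
  proof eventually_elim
    case (elim n)
    define X where "X = (\<Sum>k=1..N n. p n k * (1 - p n k) * (real k)\<^sup>2)"
    have "S n = X / m n ^ 4"
      by (simp add: S_def X_def p_def sum_divide_distrib m_power mult_ac power_divide)
    moreover have "m n ^ 6 = m n ^ 4 * m n ^ 2" by (simp flip: power_add)
    moreover have "sqrt (real n) = m n ^ 2" by (simp add: m_power)
    ultimately have "(S n - sqrt (real n) * V) / sqrt (real n) + V = X / m n ^ 6"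
      using m_pos[OF elim] by (simp add: diff_divide_distrib)
    then show ?case by (simp only: X_def)
  qed
  ultimately show ?thesis by (auto intro: Lim_transform_eventually)
qed

text \<open>\<open>Z\<close> is centered at the exact mean and \<open>W\<close> is the Gaussian with
  the exact variance; these are compared first. The phase that shifts the center from the mean to
  \<open>n\<close> tends to 1.\<close>

lemma Psi_tendsto: "(\<lambda>n. Psi n x) \<longlonglongrightarrow> of_real (exp (- (V * x\<^sup>2 / 2)))"
proof -
  define mu where "mu n = (\<Sum>k=1..N n. p n k * real k)" for n
  define var where "var n = (\<Sum>k=1..N n. p n k * (1 - p n k) * (real k)\<^sup>2)" for n
  define Z where "Z n = (\<Prod>k=1..N n. 1 + of_real (p n k) * (iexp (real k * (x / m n ^ 3)) - 1))
               * iexp (- (mu n * (x / m n ^ 3)))" for n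
  define W where "W n = complex_of_real (exp (- ((x / m n ^ 3)\<^sup>2 * var n / 2)))" for n
  have inv_m: "(\<lambda>n. 1 / m n) \<longlonglongrightarrow> 0"
    by (intro tendsto_divide_0[OF tendsto_const] filterlim_at_top_imp_at_infinity m_at_top)
  have "(\<lambda>n. Z n - W n) \<longlonglongrightarrow> 0"
  proof (rule Lim_null_comparison)
    show "(\<lambda>n. t * ((t * \<bar>x\<bar>) ^ 3 * (1 / m n) + (t * \<bar>x\<bar>) ^ 4 * (1 / m n) ^ 2)) \<longlonglongrightarrow> 0"
      by (rule tendsto_eq_intros inv_m refl | simp)+
    show "\<forall>\<^sub>F n in sequentially. norm (Z n - W n)
        \<le> t * ((t * \<bar>x\<bar>) ^ 3 * (1 / m n) + (t * \<bar>x\<bar>) ^ 4 * (1 / m n) ^ 2)"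
      using eventually_gt_at_top[of 0]
    proof eventually_elim
      case (elim n)
      note m = m_pos[OF elim]
      have "norm (Z n - W n) \<le> real (N n) * ((real (N n) * \<bar>x / m n ^ 3\<bar>) ^ 3 + (real (N n) * \<bar>x / m n ^ 3\<bar>) ^ 4)"
        unfolding Z_def W_def mu_def var_def by (intro cmod_prod_centered_bernoulli_le p_bounds)
      also have "\<dots> \<le> (t * m n ^ 2) * ((t * m n ^ 2 * \<bar>x / m n ^ 3\<bar>) ^ 3 + (t * m n ^ 2 * \<bar>x / m n ^ 3\<bar>) ^ 4)"
        using N_le[of n] t_pos by (intro mult_mono add_mono power_mono mult_right_mono) auto
      \<comment> \<open>The largest angle is of order \<open>1 / m n\<close>; its cube times about
        \<open>t * m n ^ 2\<close> factors still tends to 0.\<close>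
      also have "t * m n ^ 2 * \<bar>x / m n ^ 3\<bar> = t * \<bar>x\<bar> / m n"
        using m by (simp add: abs_divide power2_eq_square power3_eq_cube)
      also have "(t * m n ^ 2) * ((t * \<bar>x\<bar> / m n) ^ 3 + (t * \<bar>x\<bar> / m n) ^ 4)
          = t * ((t * \<bar>x\<bar>) ^ 3 * (1 / m n) + (t * \<bar>x\<bar>) ^ 4 * (1 / m n) ^ 2)"
      proof -
        have "m n ^ 2 * ((a / m n) ^ 3 + (a / m n) ^ 4) = a ^ 3 * (1 / m n) + a ^ 4 * (1 / m n) ^ 2" for a
          using m by (simp add: field_simps power2_eq_square power3_eq_cube power4_eq_xxxx)
        from this[of "t * \<bar>x\<bar>"] show ?thesis by (simp only: mult.assoc)
      qed
      finally show ?case .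
    qed
  qed
  moreover have "W \<longlonglongrightarrow> of_real (exp (- (V * x\<^sup>2 / 2)))"
  proof -
    have "(\<lambda>n. exp (- (x\<^sup>2 * (var n / m n ^ 6) / 2))) \<longlonglongrightarrow> exp (- (x\<^sup>2 * V / 2))"
      unfolding var_def by (intro tendsto_intros variance_asymptotics) auto
    then have "(\<lambda>n. complex_of_real (exp (- (x\<^sup>2 * (var n / m n ^ 6) / 2)))) \<longlonglongrightarrow> of_real (exp (- (x\<^sup>2 * V / 2)))"
      by (rule tendsto_of_real)
    then show ?thesis
      unfolding W_def by (simp add: power_divide mult_ac flip: power_mult)
  qed
  ultimately have Z: "Z \<longlonglongrightarrow> of_real (exp (- (V * x\<^sup>2 / 2)))"
    by (rule Lim_transform[rotated])
  have "(\<lambda>n. iexp ((mu n - real n) / m n ^ 3 * x)) \<longlonglongrightarrow> iexp (0 * x)"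
    unfolding mu_def by (intro tendsto_intros mean_asymptotics)
  from tendsto_mult[OF Z this]
  have "(\<lambda>n. Z n * iexp ((mu n - real n) / m n ^ 3 * x)) \<longlonglongrightarrow> of_real (exp (- (V * x\<^sup>2 / 2)))"
    by simp
  moreover have "Z n * iexp ((mu n - real n) / m n ^ 3 * x) = Psi n x" for n
  proof -
    have "- (mu n * (x / m n ^ 3)) + (mu n - real n) / m n ^ 3 * x = - (real n * (x / m n ^ 3))"
      by (simp add: diff_divide_distrib algebra_simps)
    then have "iexp (- (mu n * (x / m n ^ 3))) * iexp ((mu n - real n) / m n ^ 3 * x) = iexp (- (real n * (x / m n ^ 3)))"
      by (simp only: exp_add[symmetric] distrib_left[symmetric] of_real_add[symmetric])
    then show ?thesis by (simp only: Z_def Psi_def mult.assoc)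
  qed
  ultimately show ?thesis by simp
qed

text \<open>An integrable majorant independent of \<open>n\<close>: the Gaussian serves the central
  range, and \<open>inverse (1 + x^2)\<close> the rest, where \<open>Psi\<close> is smaller than any
  power of \<open>m n\<close>.\<close>

lemma Psi_bound:
  obtains c where "c > 0"
    "\<forall>\<^sub>F n in sequentially. \<forall>x. \<bar>x\<bar> \<le> pi * m n ^ 3 \<longrightarrow> cmod (Psi n x) \<le> exp (- (c * x\<^sup>2 / 2)) + inverse (1 + x\<^sup>2)"
proof -
  \<comment> \<open>Compactness yields a positive lower bound \<open>a\<close> for all the Bernoulli
    variances, uniformly in \<open>n\<close> and \<open>k\<close>.\<close>
  have "\<exists>u\<in>{0..t}. \<forall>v\<in>{0..t}. logis b u * (1 - logis b u) \<le> logis b v * (1 - logis b v)"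
    using t_pos by (intro continuous_attains_inf continuous_intros) auto
  then obtain u where u: "\<And>v. v \<in> {0..t} \<Longrightarrow> logis b u * (1 - logis b u) \<le> logis b v * (1 - logis b v)"
    by blast
  define a where "a = logis b u * (1 - logis b u)"
  have a: "a > 0" unfolding a_def using logis_pos[of b u] logis_less_1[of b u] by simp
  have cmod_le: "cmod (Psi n x) \<le> exp (- (a * (\<Sum>k=1..N n. 1 - cos (real k * (x / m n ^ 3)))))"
    if n: "n > 0" for n x
  proof -
    have "cmod (Psi n x) = (\<Prod>k=1..N n. cmod (1 + of_real (p n k) * (iexp (real k * (x / m n ^ 3)) - 1)))"
      unfolding Psi_def norm_mult norm_exp_i_times prod_norm by simp
    also have "\<dots> \<le> (\<Prod>k=1..N n. exp (- (a * (1 - cos (real k * (x / m n ^ 3))))))"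
    proof (intro prod_mono conjI norm_ge_zero)
      fix k assume k: "k \<in> {1..N n}"
      have "real k \<le> t * sqrt (real n)" using k N_le[of n] by (auto simp: m_power)
      then have "real k / sqrt (real n) \<in> {0..t}" using n by (simp add: field_simps)
      then have "a \<le> p n k * (1 - p n k)" unfolding a_def p_def by (rule u)
      then have "a * (1 - cos (real k * (x / m n ^ 3))) \<le> p n k * (1 - p n k) * (1 - cos (real k * (x / m n ^ 3)))"
        by (intro mult_right_mono) auto
      then have "exp (- (p n k * (1 - p n k) * (1 - cos (real k * (x / m n ^ 3)))))
          \<le> exp (- (a * (1 - cos (real k * (x / m n ^ 3)))))" by simp
      with cmod_bernoulli_char_le show "cmod (1 + of_real (p n k) * (iexp (real k * (x / m n ^ 3)) - 1))
          \<le> exp (- (a * (1 - cos (real k * (x / m n ^ 3)))))"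
        by (rule order_trans)
    qed
    also have "\<dots> = exp (- (a * (\<Sum>k=1..N n. 1 - cos (real k * (x / m n ^ 3)))))"
      by (simp only: exp_sum[symmetric] finite_atLeastAtMost sum_negf sum_distrib_left)
    finally show ?thesis .
  qed
  text \<open>With \<open>N n\<close> at least \<open>t * m n ^ 2 / 2\<close>, \<open>c\<close> gives the Gaussian decay where \<open>N n * \<bar>x\<bar> \<le> pi * m n ^ 3\<close>,
    and \<open>d\<close> the decay of the remaining arcs.\<close>
  define c where "c = a * t ^ 3 / (6 * pi\<^sup>2)"
  have c: "c > 0" using a t_pos by (simp add: c_def)
  define d where "d = a * t / 4"
  have d: "d > 0" using a t_pos by (simp add: d_def)
  \<comment> \<open>On the range of integration \<open>x^2\<close> is at most
    \<open>pi^2 * m n ^ 6\<close>, so exponential decay beats \<open>1 + x^2\<close> there.\<close>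
  have "(\<lambda>n. exp (- (d * m n ^ 2)) * (1 + pi\<^sup>2 * m n ^ 6)) \<longlonglongrightarrow> 0"
  proof -
    have y: "filterlim (\<lambda>n. d * m n ^ 2) at_top sequentially"
      by (intro filterlim_tendsto_pos_mult_at_top[OF tendsto_const d] filterlim_pow_at_top m_at_top) simp
    have "(\<lambda>n. (d * m n ^ 2) ^ 0 / exp (d * m n ^ 2) + pi\<^sup>2 / d ^ 3 * ((d * m n ^ 2) ^ 3 / exp (d * m n ^ 2)))
        \<longlonglongrightarrow> 0 + pi\<^sup>2 / d ^ 3 * 0"
      by (intro tendsto_add tendsto_mult tendsto_const filterlim_compose[OF tendsto_power_div_exp_0 y])
    moreover have "(d * m n ^ 2) ^ 0 / exp (d * m n ^ 2) + pi\<^sup>2 / d ^ 3 * ((d * m n ^ 2) ^ 3 / exp (d * m n ^ 2))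
       = exp (- (d * m n ^ 2)) * (1 + pi\<^sup>2 * m n ^ 6)" for n
      using d by (simp add: exp_minus field_simps flip: power_mult)
    ultimately show ?thesis by simp
  qed
  then have "\<forall>\<^sub>F n in sequentially. exp (- (d * m n ^ 2)) * (1 + pi\<^sup>2 * m n ^ 6) < 1"
    by (rule order_tendstoD(2)) simp
  \<comment> \<open>Then \<open>t * m n ^ 2 / 2 >= 1\<close> absorbs the loss from the floor in
    \<open>N n\<close>.\<close>
  moreover have "\<forall>\<^sub>F n in sequentially. m n ^ 2 \<ge> 2 / t"
    using filterlim_pow_at_top[OF _ m_at_top, of 2] by (simp add: filterlim_at_top)
  ultimately have "\<forall>\<^sub>F n in sequentially. \<forall>x. \<bar>x\<bar> \<le> pi * m n ^ 3 \<longrightarrow>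
      cmod (Psi n x) \<le> exp (- (c * x\<^sup>2 / 2)) + inverse (1 + x\<^sup>2)"
    using eventually_gt_at_top[of 0]
  proof eventually_elim
    case (elim n)
    show ?case
    proof (intro allI impI)
      fix x assume x: "\<bar>x\<bar> \<le> pi * m n ^ 3"
      define \<theta> where "\<theta> = x / m n ^ 3"
      define S where "S = (\<Sum>k=1..N n. 1 - cos (real k * \<theta>))"
      note m = m_pos[OF elim(3)]
      have \<theta>: "\<bar>\<theta>\<bar> \<le> pi" using x m by (simp add: \<theta>_def abs_divide field_simps)
      have N: "t * m n ^ 2 / 2 \<le> real (N n)"
        using N_ge[of n] elim(2) t_pos by (simp add: field_simps)
      have le: "cmod (Psi n x) \<le> exp (- (a * S))"
        using cmod_le[OF elim(3), of x] by (simp add: S_def \<theta>_def)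
      show "cmod (Psi n x) \<le> exp (- (c * x\<^sup>2 / 2)) + inverse (1 + x\<^sup>2)"
      proof (cases "real (N n) * \<bar>\<theta>\<bar> \<le> pi")
        case True
        have "c * x\<^sup>2 / 2 = a * (2 * \<theta>\<^sup>2 / (3 * pi\<^sup>2) * (t * m n ^ 2 / 2) ^ 3)"
          using m by (simp add: c_def \<theta>_def power_divide power_mult_distrib flip: power_mult)
        also have "\<dots> \<le> a * (2 * \<theta>\<^sup>2 / (3 * pi\<^sup>2) * real (N n) ^ 3)"
          using a N t_pos by (intro mult_left_mono power_mono) auto
        also have "\<dots> \<le> a * S"
          unfolding S_def using a by (intro mult_left_mono sum_one_minus_cos_ge_small[OF True]) auto
        finally have "exp (- (a * S)) \<le> exp (- (c * x\<^sup>2 / 2))" by simp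
        moreover have "0 \<le> inverse (1 + x\<^sup>2)" by simp
        ultimately show ?thesis using le by linarith
      next
        case False
        have "d * m n ^ 2 = a * (t * m n ^ 2 / 2 / 2)" by (simp add: d_def)
        also have "\<dots> \<le> a * (real (N n) / 2)"
          using a N by (intro mult_left_mono divide_right_mono) auto
        also have "\<dots> \<le> a * S"
          using a sum_one_minus_cos_ge_large[of "N n" \<theta>] False \<theta> by (simp add: S_def)
        finally have "exp (- (a * S)) \<le> exp (- (d * m n ^ 2))" by simp
        with le have "cmod (Psi n x) \<le> exp (- (d * m n ^ 2))" by (rule order_trans)
        also have "\<dots> \<le> inverse (1 + x\<^sup>2)"
        proof -
          have "x\<^sup>2 \<le> (pi * m n ^ 3)\<^sup>2" using x by (metis abs_ge_zero power2_abs power_mono)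
          then have "exp (- (d * m n ^ 2)) * (1 + x\<^sup>2) \<le> exp (- (d * m n ^ 2)) * (1 + pi\<^sup>2 * m n ^ 6)"
            by (intro mult_left_mono) (auto simp: power_mult_distrib simp flip: power_mult)
          also have "\<dots> \<le> 1" using elim(1) by simp
          finally show ?thesis by (simp add: add_pos_nonneg field_simps)
        qed
        finally show ?thesis using exp_gt_zero[of "- (c * x\<^sup>2 / 2)"] by linarith
      qed
    qed
  qed
  with c that show thesis by blast
qed

section \<open>Limit of the Fourier integral\<close>

lemma continuous_on_Psi: "continuous_on A (Psi n)"
  unfolding Psi_def divide_inverse by (intro continuous_intros)

lemma Psi_integral_tendsto:
  "(\<lambda>n. LINT x:{- (pi * m n ^ 3)..pi * m n ^ 3}|lborel. Psi n x) \<longlonglongrightarrow> of_real (sqrt (2 * pi / V))"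
proof -
  obtain c where c: "c > 0" and bound: "\<forall>\<^sub>F n in sequentially. \<forall>x. \<bar>x\<bar> \<le> pi * m n ^ 3 \<longrightarrow>
      cmod (Psi n x) \<le> exp (- (c * x\<^sup>2 / 2)) + inverse (1 + x\<^sup>2)"
    by (rule Psi_bound)
  define D where "D n = {- (pi * m n ^ 3)..pi * m n ^ 3}" for n
  obtain n0 where "\<forall>n\<ge>n0. \<forall>x. \<bar>x\<bar> \<le> pi * m n ^ 3 \<longrightarrow>
      cmod (Psi n x) \<le> exp (- (c * x\<^sup>2 / 2)) + inverse (1 + x\<^sup>2)"
    using bound unfolding eventually_sequentially by blast
  then have n0: "cmod (Psi n x) \<le> exp (- (c * x\<^sup>2 / 2)) + inverse (1 + x\<^sup>2)"
    if "n \<ge> n0" "x \<in> D n" for n x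
    using that by (auto simp: D_def abs_le_iff)
  \<comment> \<open>The majorant holds only from \<open>n0\<close> on, while dominated convergence
    asks for it at every index; hence the shift. The indicator puts the growing intervals on one
    common domain.\<close>
  have "(\<lambda>n. LINT x|lborel. indicator (D (n + n0)) x *\<^sub>R Psi (n + n0) x)
      \<longlonglongrightarrow> (LINT x|lborel. complex_of_real (exp (- (V * x\<^sup>2 / 2))))"
  proof (rule integral_dominated_convergence)
    show "(\<lambda>x. complex_of_real (exp (- (V * x\<^sup>2 / 2)))) \<in> borel_measurable lborel"
      by measurable
    show "(\<lambda>x. indicator (D (n + n0)) x *\<^sub>R Psi (n + n0) x) \<in> borel_measurable lborel" for n
    proof -
      have "Psi (n + n0) \<in> borel_measurable borel"
        by (intro borel_measurable_continuous_onI continuous_on_Psi)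
      then show ?thesis unfolding D_def by measurable
    qed
    have "integrable lborel (\<lambda>x::real. inverse (1 + x\<^sup>2))"
      using integrable_inverse_1_plus_square by (simp add: set_integrable_def einterval_eq)
    then show "integrable lborel (\<lambda>x. exp (- (c * x\<^sup>2 / 2)) + inverse (1 + x\<^sup>2))"
      using gaussian_integral(1)[OF c] by (rule Bochner_Integration.integrable_add[rotated])
    show "AE x in lborel. (\<lambda>n. indicator (D (n + n0)) x *\<^sub>R Psi (n + n0) x)
        \<longlonglongrightarrow> complex_of_real (exp (- (V * x\<^sup>2 / 2)))"
    proof (rule AE_I2)
      fix x
      have "filterlim (\<lambda>n. pi * m n ^ 3) at_top sequentially"
        by (intro filterlim_tendsto_pos_mult_at_top[OF tendsto_const pi_gt_zero] filterlim_pow_at_top m_at_top) simp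
      then have "\<forall>\<^sub>F n in sequentially. \<bar>x\<bar> \<le> pi * m n ^ 3"
        by (simp add: filterlim_at_top)
      then have "\<forall>\<^sub>F n in sequentially. Psi n x = indicator (D n) x *\<^sub>R Psi n x"
        by eventually_elim (auto simp: D_def indicator_def abs_le_iff)
      then have "(\<lambda>n. indicator (D n) x *\<^sub>R Psi n x) \<longlonglongrightarrow> complex_of_real (exp (- (V * x\<^sup>2 / 2)))"
        by (rule Lim_transform_eventually[OF Psi_tendsto])
      then show "(\<lambda>n. indicator (D (n + n0)) x *\<^sub>R Psi (n + n0) x)
          \<longlonglongrightarrow> complex_of_real (exp (- (V * x\<^sup>2 / 2)))"
        by (rule LIMSEQ_ignore_initial_segment)
    qed
    show "AE x in lborel. norm (indicator (D (n + n0)) x *\<^sub>R Psi (n + n0) x)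
        \<le> exp (- (c * x\<^sup>2 / 2)) + inverse (1 + x\<^sup>2)" for n
    proof (rule AE_I2)
      fix x
      have "0 \<le> exp (- (c * x\<^sup>2 / 2)) + inverse (1 + x\<^sup>2)"
        by (intro add_nonneg_nonneg) auto
      then show "norm (indicator (D (n + n0)) x *\<^sub>R Psi (n + n0) x)
        \<le> exp (- (c * x\<^sup>2 / 2)) + inverse (1 + x\<^sup>2)"
        using n0[of "n + n0" x] by (auto simp: indicator_def)
    qed
  qed
  then have "(\<lambda>n. LINT x|lborel. indicator (D n) x *\<^sub>R Psi n x)
      \<longlonglongrightarrow> (LINT x|lborel. complex_of_real (exp (- (V * x\<^sup>2 / 2))))"
    by (rule LIMSEQ_offset)
  then show ?thesis
    by (simp only: set_lebesgue_integral_def D_def integral_complex_of_real gaussian_integral(2)[OF V_pos])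
qed

section \<open>Fourier inversion and the count of partitions\<close>

lemma d_part_eq_card: "d_part t n = card {S \<in> Pow {1..N n}. \<Sum>S = n}"
proof -
  have "{k. 1 \<le> k \<and> real k \<le> t * sqrt (real n)} = {1..N n}"
    using t_pos by (auto simp: N_def le_nat_floor le_nat_iff le_floor_iff)
  then show ?thesis
    using bij_betw_same_card[OF bounded_distinct_partitions_conv[of t n]]
    by (simp add: d_part_def)
qed

lemma weight_pos: "weight n > 0"
  unfolding weight_def by (intro prod_pos) auto

text \<open>Multiplying by \<open>weight n\<close> clears the denominators, each factor becoming
  \<open>1 + q k * iexp (real k * \<theta>)\<close>; expanding the product gives one term per set of
  parts.\<close>

lemma Psi_eq_sum:
  "of_real (weight n) * Psi n x = (\<Sum>S\<in>Pow {1..N n}.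
      of_real (exp (- b * (real (\<Sum>S) / sqrt (real n)))) * iexp (of_int (int (\<Sum>S) - int n) * (x / m n ^ 3)))"
proof -
  define \<theta> where "\<theta> = x / m n ^ 3"
  define q where "q k = exp (- b * (real k / sqrt (real n)))" for k
  have fac: "of_real (1 + q k) * (1 + of_real (p n k) * (iexp (real k * \<theta>) - 1))
      = of_real (q k) * iexp (real k * \<theta>) + 1" for k
  proof -
    have "(1 + q k) * p n k = q k"
      unfolding p_def logis_def q_def by simp
    then have "of_real (1 + q k) * of_real (p n k) = complex_of_real (q k)"
      by (metis of_real_mult)
    then have "of_real (1 + q k) * (1 + of_real (p n k) * (iexp (real k * \<theta>) - 1))
       = of_real (1 + q k) + of_real (q k) * (iexp (real k * \<theta>) - 1)"
      by (simp only: distrib_left mult.assoc[symmetric] mult_1_right)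
    then show ?thesis by (simp add: algebra_simps)
  qed
  have q: "(\<Prod>k\<in>S. of_real (q k)) = complex_of_real (exp (- b * (real (\<Sum>S) / sqrt (real n))))"
    if "finite S" for S
  proof -
    have "(\<Prod>k\<in>S. q k) = exp (\<Sum>k\<in>S. - b * (real k / sqrt (real n)))"
      unfolding q_def using that by (simp only: exp_sum)
    also have "(\<Sum>k\<in>S. - b * (real k / sqrt (real n))) = - b * (real (\<Sum>S) / sqrt (real n))"
      by (simp add: sum_distrib_left sum_divide_distrib)
    finally show ?thesis by (simp only: of_real_prod[symmetric])
  qed
  have e: "(\<Prod>k\<in>S. iexp (real k * \<theta>)) * iexp (- (real n * \<theta>)) = iexp (of_int (int (\<Sum>S) - int n) * \<theta>)"
    if "finite S" for S
  proof -
    have "(\<Prod>k\<in>S. iexp (real k * \<theta>)) = iexp (real (\<Sum>S) * \<theta>)"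
      using that by (simp add: sum_distrib_right sum_distrib_left flip: exp_sum)
    then have "(\<Prod>k\<in>S. iexp (real k * \<theta>)) * iexp (- (real n * \<theta>))
        = iexp (real (\<Sum>S) * \<theta> + - (real n * \<theta>))"
      by (simp only: exp_add[symmetric] distrib_left[symmetric] of_real_add[symmetric])
    also have "real (\<Sum>S) * \<theta> + - (real n * \<theta>) = of_int (int (\<Sum>S) - int n) * \<theta>"
      by (simp add: algebra_simps del: of_nat_sum)
    finally show ?thesis .
  qed
  have "of_real (weight n) * Psi n x
      = (\<Prod>k=1..N n. of_real (1 + q k) * (1 + of_real (p n k) * (iexp (real k * \<theta>) - 1))) * iexp (- (real n * \<theta>))"
    by (simp only: weight_def Psi_def \<theta>_def[symmetric] q_def[symmetric] of_real_prod prod.distrib mult.assoc)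
  also have "\<dots> = (\<Sum>S\<in>Pow {1..N n}. (\<Prod>k\<in>S. of_real (q k) * iexp (real k * \<theta>))) * iexp (- (real n * \<theta>))"
    unfolding fac by (subst prod_add) simp_all
  also have "\<dots> = (\<Sum>S\<in>Pow {1..N n}. (\<Prod>k\<in>S. of_real (q k)) *
      ((\<Prod>k\<in>S. iexp (real k * \<theta>)) * iexp (- (real n * \<theta>))))"
    by (simp only: prod.distrib sum_distrib_right mult.assoc)
  also have "\<dots> = (\<Sum>S\<in>Pow {1..N n}.
      of_real (exp (- b * (real (\<Sum>S) / sqrt (real n)))) * iexp (of_int (int (\<Sum>S) - int n) * \<theta>))"
  proof (intro sum.cong refl)
    fix S assume "S \<in> Pow {1..N n}"
    then have "finite S" by (auto intro: finite_subset)
    then show "(\<Prod>k\<in>S. of_real (q k)) * ((\<Prod>k\<in>S. iexp (real k * \<theta>)) * iexp (- (real n * \<theta>)))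
      = of_real (exp (- b * (real (\<Sum>S) / sqrt (real n)))) * iexp (of_int (int (\<Sum>S) - int n) * \<theta>)"
      by (simp only: e q)
  qed
  finally show ?thesis by (simp only: \<theta>_def)
qed

text \<open>Orthogonality keeps only the sets with sum \<open>n\<close>. All of these carry the same
  tilt \<open>exp (- b * sqrt n)\<close>, so the integral counts them.\<close>

lemma Psi_integral:
  assumes n: "n > 0"
  shows "(LINT x:{- (pi * m n ^ 3)..pi * m n ^ 3}|lborel. Psi n x)
     = of_real (2 * pi * m n ^ 3 * real (d_part t n) * exp (- b * sqrt (real n)) / weight n)"
proof -
  define D where "D = {- (pi * m n ^ 3)..pi * m n ^ 3}"
  define I where "I = (LINT x:D|lborel. Psi n x)"
  have R: "m n ^ 3 > 0" using m_pos[OF n] by simp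
  have "set_integrable lborel D (Psi n)"
    unfolding D_def by (intro borel_integrable_atLeastAtMost' continuous_on_Psi)
  then have "(Psi n has_integral I) D"
    unfolding I_def using set_borel_integral_eq_integral[of D "Psi n"] by (simp add: integrable_integral)
  then have 1: "((\<lambda>x. of_real (weight n) * Psi n x) has_integral (of_real (weight n) * I)) D"
    by (rule has_integral_mult_right)
  have "((\<lambda>x. of_real (weight n) * Psi n x) has_integral (\<Sum>S\<in>Pow {1..N n}.
      of_real (exp (- b * (real (\<Sum>S) / sqrt (real n)))) *
        (if int (\<Sum>S) - int n = 0 then of_real (2 * pi * m n ^ 3) else 0))) D"
    unfolding Psi_eq_sum D_def
    by (intro has_integral_sum has_integral_mult_right iexp_has_integral_period R) simp
  then have "of_real (weight n) * I = (\<Sum>S\<in>Pow {1..N n}.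
      of_real (exp (- b * (real (\<Sum>S) / sqrt (real n)))) *
        (if int (\<Sum>S) - int n = 0 then of_real (2 * pi * m n ^ 3) else 0))"
    by (rule has_integral_unique[OF 1])
  also have "\<dots> = (\<Sum>S\<in>Pow {1..N n}.
      if \<Sum>S = n then of_real (exp (- b * sqrt (real n)) * (2 * pi * m n ^ 3)) else 0)"
  proof (intro sum.cong refl)
    fix S :: "nat set"
    have "real n / sqrt (real n) = sqrt (real n)" by (simp add: real_div_sqrt)
    then show "of_real (exp (- b * (real (\<Sum>S) / sqrt (real n)))) *
        (if int (\<Sum>S) - int n = 0 then of_real (2 * pi * m n ^ 3) else 0)
      = (if \<Sum>S = n then complex_of_real (exp (- b * sqrt (real n)) * (2 * pi * m n ^ 3)) else 0)"
      by (cases "\<Sum>S = n") (simp_all del: of_nat_sum times_divide_eq_right)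
  qed
  also have "\<dots> = of_nat (d_part t n) * of_real (exp (- b * sqrt (real n)) * (2 * pi * m n ^ 3))"
    by (simp add: d_part_eq_card sum.If_cases Int_def)
  finally have "of_real (weight n) * I = of_real (2 * pi * m n ^ 3 * real (d_part t n) * exp (- b * sqrt (real n)))"
    by (simp add: mult_ac)
  then show ?thesis
    using weight_pos[of n] by (simp add: I_def D_def field_simps)
qed

lemma d_part_scaled_tendsto:
  "(\<lambda>n. 2 * pi * m n ^ 3 * real (d_part t n) * exp (- b * sqrt (real n)) / weight n)
     \<longlonglongrightarrow> sqrt (2 * pi / V)"
proof -
  have "\<forall>\<^sub>F n in sequentially. (LINT x:{- (pi * m n ^ 3)..pi * m n ^ 3}|lborel. Psi n x)
     = of_real (2 * pi * m n ^ 3 * real (d_part t n) * exp (- b * sqrt (real n)) / weight n)"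
    using eventually_gt_at_top[of 0] by eventually_elim (rule Psi_integral)
  from Lim_transform_eventually[OF Psi_integral_tendsto this] show ?thesis
    by (simp only: tendsto_of_real_iff)
qed

text \<open>The logarithm of the product is a Riemann sum. Its integral is
  \<open>t * ln w + b\<close> because the moment is 1; the endpoint correction
  \<open>(ln w - ln 2) / 2\<close> becomes the square root, and the incomplete last interval the
  power of \<open>w\<close>.\<close>

lemma weight_asymptotics:
  "(\<lambda>n. weight n * exp (- (sqrt (real n) * (t * ln (1 + exp (- b * t)) + b)))
      * (1 + exp (- b * t)) powr frac (t * sqrt (real n))) \<longlonglongrightarrow> sqrt ((1 + exp (- b * t)) / 2)"
proof -
  define w where "w = 1 + exp (- b * t)"
  have w: "w > 0" by (simp add: w_def)
  define I where "I = t * ln w + b"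
  define S where "S n = (\<Sum>k=1..N n. ln (1 + exp (- b * (real k / sqrt (real n)))))" for n
  define E where "E n = S n - (sqrt (real n) * I - frac (t * sqrt (real n)) * ln w + (ln w - ln 2) / 2)" for n
  have d2: "((\<lambda>u. - b * logis b u) has_real_derivative b\<^sup>2 * (logis b u * (1 - logis b u))) (at u)" for u
    by (auto intro!: derivative_eq_intros simp: power2_eq_square)
  have int: "((\<lambda>u. ln (1 + exp (- b * u))) has_integral I) {0..t}"
    using log_partition_has_integral[of t b] t_pos by (simp add: I_def w_def moment_eq_1)
  have c: "continuous_on {0..t} (\<lambda>u. b\<^sup>2 * (logis b u * (1 - logis b u)))"
    by (intro continuous_intros)
  have "E \<longlonglongrightarrow> 0"
    using sum_asymptotics[OF t_pos log_partition_deriv d2 c int]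
    by (simp add: E_def[abs_def] S_def N_def w_def)
  then have "(\<lambda>n. exp (E n) * exp ((ln w - ln 2) / 2)) \<longlonglongrightarrow> exp 0 * exp ((ln w - ln 2) / 2)"
    by (intro tendsto_intros)
  moreover have "exp ((ln w - ln 2) / 2) = sqrt (w / 2)"
    using w ln_div[of w 2] by (simp add: powr_def flip: powr_half_sqrt)
  moreover have "exp (E n) * exp ((ln w - ln 2) / 2)
      = weight n * exp (- (sqrt (real n) * I)) * w powr frac (t * sqrt (real n))" for n
  proof -
    have "exp (S n) = weight n"
      by (simp add: S_def weight_def exp_sum)
    moreover have "w powr frac (t * sqrt (real n)) = exp (frac (t * sqrt (real n)) * ln w)"
      using w by (simp add: powr_def)
    moreover have "E n + (ln w - ln 2) / 2 = S n + - (sqrt (real n) * I) + frac (t * sqrt (real n)) * ln w"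
      by (simp add: E_def)
    ultimately show ?thesis by (metis exp_add)
  qed
  ultimately show ?thesis by (simp add: w_def I_def)
qed

end

section \<open>Assembly of the constants\<close>

theorem theorem1:
  fixes t :: real
  assumes "t > sqrt 2"
  shows "(\<lambda>n. real (d_part t n)) \<sim>[at_top]
           (\<lambda>n. A_coef n t / real n powr (3 / 4) * exp (B_exp t * sqrt (real n)))"
proof -
  define b where "b = beta t"
  have t0: "t > 0" using assms real_sqrt_gt_zero[of 2] by linarith
  interpret saddle_point t b
    using t0 moment_beta[OF assms] by unfold_locales (simp_all add: b_def)
  define w where "w = 1 + exp (- b * t)"
  have w: "w > 0" by (simp add: w_def)
  define r where "r n = frac (t * sqrt (real n))" for n :: nat
  \<comment> \<open>The part of \<open>A_coef\<close> that does not depend on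
    \<open>n\<close>.\<close>
  define s where "s = (exp (b * t / 2) + exp (- (b * t / 2))) / 2 * sqrt (deriv beta t / (pi * t))"
  have deriv: "deriv beta t / (pi * t) = logis b t / (pi * V)"
    using DERIV_imp_deriv[OF beta_deriv[OF assms], folded b_def, folded V_def] t0 by simp
  have s: "s > 0"
    unfolding s_def deriv using V_pos logis_pos[of b t] by (simp add: add_pos_pos)
  \<comment> \<open>The hyperbolic cosine in \<open>s\<close> is designed for this: its double is
    \<open>w * exp (b * t / 2) = sqrt (w / logis b t)\<close>, so the factor
    \<open>logis b t\<close> from the derivative of \<open>beta\<close> cancels.\<close>
  have const: "sqrt (2 * pi / V) * sqrt (w / 2) / (2 * pi * s) = 1"
  proof -
    have "exp (b * t / 2) + exp (- (b * t / 2)) = w * exp (b * t / 2)"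
      by (simp add: w_def distrib_right flip: exp_add)
    also have "\<dots> = sqrt (w / logis b t)"
    proof (rule real_sqrt_unique[symmetric])
      have "(exp (b * t / 2))\<^sup>2 = exp (b * t)" by (simp flip: exp_double)
      moreover have "logis b t = exp (- (b * t)) / w" by (simp add: logis_def w_def)
      then have "w / logis b t = w\<^sup>2 * exp (b * t)"
        by (simp add: exp_minus power2_eq_square field_simps)
      ultimately show "(w * exp (b * t / 2))\<^sup>2 = w / logis b t"
        by (simp add: power_mult_distrib)
    qed (use w in simp)
    finally have e: "exp (b * t / 2) + exp (- (b * t / 2)) = sqrt (w / logis b t)" .
    have "2 * s = sqrt (w / logis b t) * sqrt (logis b t / (pi * V))"
      unfolding s_def deriv e by simp
    also have "\<dots> = sqrt (w / logis b t * (logis b t / (pi * V)))"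
      by (rule real_sqrt_mult[symmetric])
    also have "w / logis b t * (logis b t / (pi * V)) = w / (pi * V)"
      using logis_pos[of b t] by simp
    finally have "2 * pi * s = pi * sqrt (w / (pi * V))" by simp
    also have "\<dots> = sqrt (pi\<^sup>2 * (w / (pi * V)))" by (simp only: real_sqrt_mult real_sqrt_pow2 real_sqrt_abs) simp
    also have "pi\<^sup>2 * (w / (pi * V)) = (2 * pi / V) * (w / 2)"
      by (simp add: power2_eq_square)
    finally have "2 * pi * s = sqrt (2 * pi / V) * sqrt (w / 2)" by (simp only: real_sqrt_mult)
    then show ?thesis using s w V_pos by simp
  qed
  \<comment> \<open>In the product of the two limits \<open>weight n\<close> cancels, and what
    remains is the quotient of \<open>d_part\<close> by its claimed equivalent.\<close>
  have "(\<lambda>n. (2 * pi * m n ^ 3 * real (d_part t n) * exp (- b * sqrt (real n)) / weight n)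
      * (weight n * exp (- (sqrt (real n) * (t * ln w + b))) * w powr r n) / (2 * pi * s))
      \<longlonglongrightarrow> sqrt (2 * pi / V) * sqrt (w / 2) / (2 * pi * s)"
    using s unfolding w_def r_def
    by (intro tendsto_divide tendsto_mult d_part_scaled_tendsto weight_asymptotics tendsto_const) auto
  then have lim: "(\<lambda>n. (2 * pi * m n ^ 3 * real (d_part t n) * exp (- b * sqrt (real n)) / weight n)
      * (weight n * exp (- (sqrt (real n) * (t * ln w + b))) * w powr r n) / (2 * pi * s)) \<longlonglongrightarrow> 1"
    unfolding const .
  have "\<forall>\<^sub>F n in sequentially.
     (2 * pi * m n ^ 3 * real (d_part t n) * exp (- b * sqrt (real n)) / weight n)
      * (weight n * exp (- (sqrt (real n) * (t * ln w + b))) * w powr r n) / (2 * pi * s)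
     = real (d_part t n) / (A_coef n t / real n powr (3 / 4) * exp (B_exp t * sqrt (real n)))"
    using eventually_gt_at_top[of 0]
  proof eventually_elim
    case (elim n)
    have A: "A_coef n t = s / w powr r n"
      by (simp add: A_coef_def s_def w_def r_def b_def)
    have "exp (- b * sqrt (real n)) * exp (- (sqrt (real n) * (t * ln w + b)))
        = exp (- (B_exp t * sqrt (real n)))"
      unfolding exp_add[symmetric] by (simp add: B_exp_def w_def b_def algebra_simps)
    then have B: "exp (- b * sqrt (real n)) * exp (- (sqrt (real n) * (t * ln w + b)))
        = 1 / exp (B_exp t * sqrt (real n))"
      by (simp add: exp_minus inverse_eq_divide)
    have "(2 * pi * m n ^ 3 * real (d_part t n) * exp (- b * sqrt (real n)) / weight n)
      * (weight n * exp (- (sqrt (real n) * (t * ln w + b))) * w powr r n) / (2 * pi * s)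
      = m n ^ 3 * real (d_part t n) * w powr r n / s *
         (exp (- b * sqrt (real n)) * exp (- (sqrt (real n) * (t * ln w + b))))"
      using weight_pos[of n] s by (simp add: field_simps)
    also have "\<dots> = real (d_part t n) / (A_coef n t / m n ^ 3 * exp (B_exp t * sqrt (real n)))"
      unfolding B A by simp
    finally show ?case by (simp only: m_power)
  qed
  from Lim_transform_eventually[OF lim this] show ?thesis
    by (rule asymp_equivI')
qed

end
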